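(* Let $\mathbb K$ be a field of characteristic zero. (A) Let $\{a_1,\dots,a_n\}$ be a set of $n$ linearly independent, mutually commuting $n\times n$ matrices with entries in $\mathbb K$, and let $\mathfrak B$ be the $\mathbb K$-vector space spanned by $a_1,\dots,a_n$, regarded as an Abelian Lie subalgebra of $\mathfrak{gl}(n,\mathbb K)$. Suppose that the action $\mathfrak B\times(\mathbb K^n)^*\to(\mathbb K^n)^*$, $(a,f)\mapsto -f\circ a$, has an open orbit in $(\mathbb K^n)^*$. Let $\mathcal G:=\mathfrak B\ltimes\mathbb K^n$ be the vector space $\mathfrak B\oplus\mathbb K^n$ endowed with the Lie bracket defined, for all $a,b\in\mathfrak B$ and $x,y\in\mathbb K^n$, by $[a,b]=[x,y]=0$ and $[a,x]=ax$. Then $\mathcal G$ is a 2-step solvable Frobenius Lie algebra. (B) Conversely, any 2-step solvable Frobenius Lie algebra over $\mathbb K$ is isomorphic to a Lie algebra constructed as in (A), for some $n$ and some such $a_1,\dots,a_n$.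
   Context: All Lie algebras are finite dimensional. For a Lie subalgebra $\mathfrak B$ of $\mathfrak{gl}(n,\mathbb K)$, the action $(a,f)\mapsto -f\circ a$ is said to have an open orbit if there is $\alpha\in(\mathbb K^n)^*$ whose orbit is open, meaning that $\{-\alpha\circ a : a\in\mathfrak B\}=(\mathbb K^n)^*$. A Lie algebra $\mathcal G$ is 2-step solvable if its derived ideal $[\mathcal G,\mathcal G]$ is Abelian. A Lie algebra $\mathcal G$ is Frobenius if there is $\alpha\in\mathcal G^*$ (a Frobenius functional) such that the skew-symmetric bilinear form $\partial\alpha(u,v):=-\alpha([u,v])$ on $\mathcal G$ is nondegenerate. *)

theory Defs
  imports "Jordan_Normal_Form.VS_Connect"
begin

section \<open>Lie algebras over a field\<close>

record ('k, 'g) lie_structure = "('k, 'g) module" +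
  lie_bracket :: "'g \<Rightarrow> 'g \<Rightarrow> 'g"

locale lie_algebra = vectorspace K G
  for K :: "('k, 'm) ring_scheme" and G :: "('k, 'g) lie_structure" +
  assumes bracket_closed:
      "\<lbrakk>x \<in> carrier G; y \<in> carrier G\<rbrakk> \<Longrightarrow> lie_bracket G x y \<in> carrier G"
    and bracket_add_left:
      "\<lbrakk>x \<in> carrier G; y \<in> carrier G; z \<in> carrier G\<rbrakk> \<Longrightarrow>
        lie_bracket G (x \<oplus>\<^bsub>G\<^esub> y) z = lie_bracket G x z \<oplus>\<^bsub>G\<^esub> lie_bracket G y z"
    and bracket_add_right:
      "\<lbrakk>x \<in> carrier G; y \<in> carrier G; z \<in> carrier G\<rbrakk> \<Longrightarrow>
        lie_bracket G x (y \<oplus>\<^bsub>G\<^esub> z) = lie_bracket G x y \<oplus>\<^bsub>G\<^esub> lie_bracket G x z"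
    and bracket_smult_left:
      "\<lbrakk>c \<in> carrier K; x \<in> carrier G; y \<in> carrier G\<rbrakk> \<Longrightarrow>
        lie_bracket G (c \<odot>\<^bsub>G\<^esub> x) y = c \<odot>\<^bsub>G\<^esub> lie_bracket G x y"
    and bracket_smult_right:
      "\<lbrakk>c \<in> carrier K; x \<in> carrier G; y \<in> carrier G\<rbrakk> \<Longrightarrow>
        lie_bracket G x (c \<odot>\<^bsub>G\<^esub> y) = c \<odot>\<^bsub>G\<^esub> lie_bracket G x y"
    and bracket_self: "x \<in> carrier G \<Longrightarrow> lie_bracket G x x = \<zero>\<^bsub>G\<^esub>"
    and jacobi:
      "\<lbrakk>x \<in> carrier G; y \<in> carrier G; z \<in> carrier G\<rbrakk> \<Longrightarrow>
        lie_bracket G x (lie_bracket G y z) \<oplus>\<^bsub>G\<^esub> lie_bracket G y (lie_bracket G z x)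
          \<oplus>\<^bsub>G\<^esub> lie_bracket G z (lie_bracket G x y) = \<zero>\<^bsub>G\<^esub>"

locale fin_dim_lie_algebra = lie_algebra +
  assumes finite_dimensional: "fin_dim"

text \<open>Functionals are extensional (undefined off the carrier), so that equality of
  functionals is equality of HOL functions.\<close>

definition dual_space ::
  "('k, 'm) ring_scheme \<Rightarrow> ('k, 'v, 'w) module_scheme \<Rightarrow> ('v \<Rightarrow> 'k) set" where
  "dual_space K V = {f \<in> carrier V \<rightarrow>\<^sub>E carrier K.
     (\<forall>x \<in> carrier V. \<forall>y \<in> carrier V. f (x \<oplus>\<^bsub>V\<^esub> y) = f x \<oplus>\<^bsub>K\<^esub> f y) \<and>
     (\<forall>c \<in> carrier K. \<forall>x \<in> carrier V. f (c \<odot>\<^bsub>V\<^esub> x) = c \<otimes>\<^bsub>K\<^esub> f x)}"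

context lie_algebra
begin

definition derived_ideal :: "'g set" where
  "derived_ideal = span {lie_bracket G x y | x y. x \<in> carrier G \<and> y \<in> carrier G}"

definition two_step_solvable :: bool where
  "two_step_solvable \<longleftrightarrow>
     (\<forall>x \<in> derived_ideal. \<forall>y \<in> derived_ideal. lie_bracket G x y = \<zero>\<^bsub>G\<^esub>)"

definition coboundary :: "('g \<Rightarrow> 'k) \<Rightarrow> 'g \<Rightarrow> 'g \<Rightarrow> 'k" where
  "coboundary \<alpha> u v = \<ominus>\<^bsub>K\<^esub> \<alpha> (lie_bracket G u v)"

text \<open>As the form is skew-symmetric, nondegeneracy need only be required in the first
  argument.\<close>

definition frobenius_functional :: "('g \<Rightarrow> 'k) \<Rightarrow> bool" where
  "frobenius_functional \<alpha> \<longleftrightarrow> \<alpha> \<in> dual_space K G \<and>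
     (\<forall>u \<in> carrier G. (\<forall>v \<in> carrier G. coboundary \<alpha> u v = \<zero>\<^bsub>K\<^esub>) \<longrightarrow> u = \<zero>\<^bsub>G\<^esub>)"

definition frobenius :: bool where
  "frobenius \<longleftrightarrow> (\<exists>\<alpha>. frobenius_functional \<alpha>)"

end

definition two_step_solvable_frobenius_lie_algebra ::
  "('k, 'm) ring_scheme \<Rightarrow> ('k, 'g) lie_structure \<Rightarrow> bool" where
  "two_step_solvable_frobenius_lie_algebra K G \<longleftrightarrow>
     fin_dim_lie_algebra K G \<and> lie_algebra.two_step_solvable K G \<and> lie_algebra.frobenius K G"

definition lie_isomorphic ::
  "('k, 'm) ring_scheme \<Rightarrow> ('k, 'g) lie_structure \<Rightarrow> ('k, 'h) lie_structure \<Rightarrow> bool" where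
  "lie_isomorphic K G H \<longleftrightarrow>
     (\<exists>\<phi>. linear_map K G H \<phi> \<and> bij_betw \<phi> (carrier G) (carrier H) \<and>
        (\<forall>x \<in> carrier G. \<forall>y \<in> carrier G.
           \<phi> (lie_bracket G x y) = lie_bracket H (\<phi> x) (\<phi> y)))"

section \<open>Semidirect products of spaces of matrices with column vectors\<close>

definition mat_span :: "nat \<Rightarrow> 'k :: field mat set \<Rightarrow> 'k mat set" where
  "mat_span n A = LinearCombinations.module.span class_ring (module_mat TYPE('k) n n) A"

definition dual_action :: "nat \<Rightarrow> 'k :: field mat \<Rightarrow> ('k vec \<Rightarrow> 'k) \<Rightarrow> 'k vec \<Rightarrow> 'k" where
  "dual_action n a f = (\<lambda>x \<in> carrier_vec n. - f (a *\<^sub>v x))"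

definition has_open_orbit :: "nat \<Rightarrow> 'k :: field mat set \<Rightarrow> bool" where
  "has_open_orbit n B \<longleftrightarrow>
     (\<exists>\<alpha> \<in> dual_space class_ring (module_vec TYPE('k) n).
        {dual_action n a \<alpha> | a. a \<in> B} = dual_space class_ring (module_vec TYPE('k) n))"

text \<open>The bracket is the bilinear skew-symmetric extension of \<open>[a, b] = [x, y] = 0\<close> and
  \<open>[a, x] = a x\<close> to pairs \<open>(a, x) = a + x\<close>; see \<open>semidirect_bracket\<close> below.\<close>

definition semidirect ::
  "nat \<Rightarrow> 'k :: field mat set \<Rightarrow> ('k, 'k mat \<times> 'k vec) lie_structure" where
  "semidirect n B =
     module.extend
       (direct_sum ((module_mat TYPE('k) n n)\<lparr>carrier := B\<rparr>) (module_vec TYPE('k) n))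
       (lie_structure.fields (\<lambda>(a, x) (b, y). (0\<^sub>m n n, a *\<^sub>v y - b *\<^sub>v x)))"

lemma semidirect_simps:
  "carrier (semidirect n B) = B \<times> carrier_vec n"
  "\<zero>\<^bsub>semidirect n B\<^esub> = (0\<^sub>m n n, 0\<^sub>v n)"
  "(a, x) \<oplus>\<^bsub>semidirect n B\<^esub> (b, y) = (a + b, x + y)"
  "c \<odot>\<^bsub>semidirect n B\<^esub> (a, x) = (c \<cdot>\<^sub>m a, c \<cdot>\<^sub>v x)"
  "lie_bracket (semidirect n B) (a, x) (b, y) = (0\<^sub>m n n, a *\<^sub>v y - b *\<^sub>v x)"
  by (simp_all add: semidirect_def module.extend_def lie_structure.fields_def direct_sum_def
      module_mat_def module_vec_def ring_mat_def)

lemma semidirect_bracket: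
  assumes "a \<in> carrier_mat n n" "b \<in> carrier_mat n n" "x \<in> carrier_vec n" "y \<in> carrier_vec n"
  shows "lie_bracket (semidirect n B) (a, 0\<^sub>v n) (b, 0\<^sub>v n) = (0\<^sub>m n n, 0\<^sub>v n)"
    and "lie_bracket (semidirect n B) (0\<^sub>m n n, x) (0\<^sub>m n n, y) = (0\<^sub>m n n, 0\<^sub>v n)"
    and "lie_bracket (semidirect n B) (a, 0\<^sub>v n) (0\<^sub>m n n, x) = (0\<^sub>m n n, a *\<^sub>v x)"
  using assms by (auto simp: semidirect_simps)

definition commuting_open_orbit_generators :: "nat \<Rightarrow> 'k :: field mat set \<Rightarrow> bool" where
  "commuting_open_orbit_generators n A \<longleftrightarrow>
     finite A \<and> card A = n \<and> A \<subseteq> carrier_mat n n \<and>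
     \<not> LinearCombinations.module.lin_dep class_ring (module_mat TYPE('k) n n) A \<and>
     (\<forall>a \<in> A. \<forall>b \<in> A. a * b = b * a) \<and>
     has_open_orbit n (mat_span n A)"

end

theory Submission
  imports Defs
begin

text \<open>
  (A) The map \<open>a \<mapsto> - \<alpha> \<circ> a\<close> from the span \<open>B\<close> of the matrices onto the dual of \<open>K\<^sup>n\<close> is a surjection between
  spaces of equal dimension, hence injective, so that \<open>(a, x) \<mapsto> \<alpha> x\<close> is a Frobenius functional.

  (B) Let \<open>\<alpha>\<close> be a Frobenius functional on \<open>G\<close>. By nondegeneracy there is an element \<open>u\<close> with
  \<open>\<alpha> [u, v] = \<alpha> v\<close> for all \<open>v\<close>. For \<open>a\<close> in the Abelian ideal \<open>[G, G]\<close> the Jacobi identity gives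
  \<open>\<alpha> [[u, a], v] = \<alpha> [u, [a, v]] - \<alpha> [a, [u, v]] = \<alpha> [a, v]\<close>, hence \<open>[u, a] = a\<close>. So \<open>ad u\<close> is a
  projection onto \<open>[G, G]\<close>, and its kernel is a complementary Abelian subalgebra. The form
  \<open>\<alpha> [b, a]\<close> pairs the kernel and \<open>[G, G]\<close> without degeneracy on either side; therefore their
  dimensions agree, the kernel acts faithfully on \<open>[G, G]\<close>, and the restriction of \<open>\<alpha>\<close> to
  \<open>[G, G]\<close> has an open orbit.
\<close>

section \<open>Linear maps and pairings of finite-dimensional spaces\<close>

lemma linear_mapI:
  assumes "vectorspace K V" "vectorspace K W"
    and "\<And>x. x \<in> carrier V \<Longrightarrow> T x \<in> carrier W"
    and "\<And>x y. \<lbrakk>x \<in> carrier V; y \<in> carrier V\<rbrakk> \<Longrightarrow> T (x \<oplus>\<^bsub>V\<^esub> y) = T x \<oplus>\<^bsub>W\<^esub> T y"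
    and "\<And>c x. \<lbrakk>c \<in> carrier K; x \<in> carrier V\<rbrakk> \<Longrightarrow> T (c \<odot>\<^bsub>V\<^esub> x) = c \<odot>\<^bsub>W\<^esub> T x"
  shows "linear_map K V W T"
  using assms
  unfolding linear_map_def mod_hom_def mod_hom_axioms_def LinearCombinations.module_hom_def
    vectorspace_def
  by auto

lemma (in vectorspace) subspaceI:
  assumes "W \<subseteq> carrier V" "\<zero>\<^bsub>V\<^esub> \<in> W"
    and "\<And>x y. \<lbrakk>x \<in> W; y \<in> W\<rbrakk> \<Longrightarrow> x \<oplus>\<^bsub>V\<^esub> y \<in> W"
    and "\<And>c x. \<lbrakk>c \<in> carrier K; x \<in> W\<rbrakk> \<Longrightarrow> c \<odot>\<^bsub>V\<^esub> x \<in> W"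
  shows "subspace K W V"
  using assms vectorspace_axioms module_axioms unfolding subspace_def submodule_def by auto

lemma (in vectorspace) subspace_subset: "subspace K W V \<Longrightarrow> W \<subseteq> carrier V"
  by (simp add: subspace_def submodule_def)

text \<open>A subset of W that is independent in W is independent in V, so its size is at most the
  dimension of V. Hence a maximal independent subset of W exists, and it is a finite basis.\<close>

lemma (in vectorspace) subspace_fin_dim:
  assumes "fin_dim" "subspace K W V"
  shows "vectorspace.fin_dim K (vs W)"
proof -
  interpret W: vectorspace K "vs W"
    by (rule subspace_is_vs[OF assms(2)])
  have sub: "submodule K W V"
    using assms(2) by (rule is_module)
  have "W \<subseteq> carrier V"
    using assms(2) by (rule subspace_subset)
  have "\<exists>S. finite S \<and> maximal S (\<lambda>S. S \<subseteq> carrier (vs W) \<and> W.module.lin_indpt S)"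
  proof (rule maximal_exists)
    fix S assume S: "S \<subseteq> carrier (vs W) \<and> W.module.lin_indpt S"
    then have "lin_indpt S"
      using span_li_not_depend(2)[of S W] sub by auto
    moreover have "S \<subseteq> carrier V"
      using S \<open>W \<subseteq> carrier V\<close> by auto
    ultimately show "finite S \<and> card S \<le> dim"
      using li_le_dim[OF assms(1)] by blast
  next
    show "{} \<subseteq> carrier (vs W) \<and> W.module.lin_indpt {}"
      by (auto simp: W.lin_dep_def)
  qed
  then show ?thesis
    using W.max_li_is_basis unfolding W.fin_dim_def W.basis_def by blast
qed

lemma (in linear_map) image_subspace:
  assumes "subspace K U V"
  shows "subspace K (T ` U) W"
proof (rule W.subspaceI)
  have sub: "submodule K U V"
    using assms by (rule V.is_module)
  have U: "U \<subseteq> carrier V"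
    using assms by (rule V.subspace_subset)
  show "T ` U \<subseteq> carrier W"
    using U T_im by auto
  show "\<zero>\<^bsub>W\<^esub> \<in> T ` U"
    using submodule.zero_closed[OF sub] T0_is_0 by (metis imageI)
  show "x \<oplus>\<^bsub>W\<^esub> y \<in> T ` U" if "x \<in> T ` U" "y \<in> T ` U" for x y
  proof -
    from that obtain u v where uv: "u \<in> U" "v \<in> U" "x = T u" "y = T v"
      by auto
    then have "x \<oplus>\<^bsub>W\<^esub> y = T (u \<oplus>\<^bsub>V\<^esub> v)"
      using U by (simp add: subset_iff)
    then show ?thesis
      using submodule.m_closed[OF sub uv(1,2)] by simp
  qed
  show "c \<odot>\<^bsub>W\<^esub> x \<in> T ` U" if "c \<in> carrier K" "x \<in> T ` U" for c x
  proof -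
    from that obtain u where u: "u \<in> U" "x = T u"
      by auto
    then have "c \<odot>\<^bsub>W\<^esub> x = T (c \<odot>\<^bsub>V\<^esub> u)"
      using U that(1) by (simp add: subset_iff)
    then show ?thesis
      using submodule.smult_closed[OF sub that(1) u(1)] by simp
  qed
qed

lemma (in linear_map) preimage_subspace:
  assumes "subspace K U W"
  shows "subspace K {v \<in> carrier V. T v \<in> U} V"
proof (rule V.subspaceI)
  have sub: "submodule K U W"
    using assms by (rule W.is_module)
  show "\<zero>\<^bsub>V\<^esub> \<in> {v \<in> carrier V. T v \<in> U}"
    using submodule.zero_closed[OF sub] T0_is_0 by auto
qed (use W.is_module[OF assms] in \<open>auto simp: submodule.m_closed submodule.smult_closed\<close>)

text \<open>Each inclusion is minimality of a span: the preimage of the span of \<open>T\<close>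
  A\<open>is a subspace containing A, and the image of the span of A is a subspace
  containing\<close>T \<open>A\<close>.\<close>

lemma (in linear_map) image_span:
  assumes "A \<subseteq> carrier V"
  shows "T ` V.module.span A = W.module.span (T ` A)"
proof
  have TA: "T ` A \<subseteq> carrier W"
    using assms T_im by auto
  let ?P = "{v \<in> carrier V. T v \<in> W.module.span (T ` A)}"
  have "subspace K ?P V"
    using TA by (intro preimage_subspace W.span_is_subspace)
  moreover have "A \<subseteq> ?P"
    using assms W.module.in_own_span[OF TA] by auto
  ultimately have "V.module.span A \<subseteq> ?P"
    by (intro V.module.span_is_subset) (auto simp: V.is_module)
  then show "T ` V.module.span A \<subseteq> W.module.span (T ` A)"
    by auto
  have "submodule K (T ` V.module.span A) W"
    using assms by (intro W.is_module image_subspace V.span_is_subspace)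
  moreover have "T ` A \<subseteq> T ` V.module.span A"
    using V.module.in_own_span[OF assms] by auto
  ultimately show "W.module.span (T ` A) \<subseteq> T ` V.module.span A"
    by (intro W.module.span_is_subset)
qed

text \<open>A relation with coefficients a among the images pulls back, by injectivity, to the
  relation with coefficients \<open>a \<circ> T\<close> on \<beta>.\<close>

lemma (in linear_map) inj_lin_indpt:
  assumes "inj_on T (carrier V)" "finite \<beta>" "\<beta> \<subseteq> carrier V" "V.module.lin_indpt \<beta>"
  shows "W.module.lin_indpt (T ` \<beta>)"
proof (rule W.module.finite_lin_indpt2)
  fix a assume a: "a \<in> T ` \<beta> \<rightarrow> carrier K" and z: "W.module.lincomb a (T ` \<beta>) = \<zero>\<^bsub>W\<^esub>"
  have aT: "a \<circ> T \<in> \<beta> \<rightarrow> carrier K"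
    using a by auto
  have "T (V.module.lincomb (a \<circ> T) \<beta>) = T \<zero>\<^bsub>V\<^esub>"
    using lincomb_linear_image[OF assms(1,3) a assms(2)] z by simp
  then have "V.module.lincomb (a \<circ> T) \<beta> = \<zero>\<^bsub>V\<^esub>"
    using inj_onD[OF assms(1)] aT assms(3) by (metis V.module.lincomb_closed V.module.M.zero_closed)
  then have "a \<circ> T \<in> \<beta> \<rightarrow> {\<zero>\<^bsub>K\<^esub>}"
    using V.not_lindepD[OF assms(4,2) _ aT] by auto
  then show "\<forall>v\<in>T ` \<beta>. a v = \<zero>\<^bsub>K\<^esub>"
    by auto
qed (use assms T_im in auto)

text \<open>The image of a basis of V is an independent set with \<open>V.dim\<close> elements. This
  bounds the dimension of W from below, and if the dimensions agree the set is a basis of W.\<close>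

lemma (in linear_map) inj_dim_le:
  assumes "V.fin_dim" "W.fin_dim" "inj_on T (carrier V)"
  shows "V.dim \<le> W.dim"
    and "W.dim \<le> V.dim \<Longrightarrow> T ` carrier V = carrier W"
proof -
  obtain \<beta> where \<beta>: "finite \<beta>" "V.basis \<beta>"
    using V.finite_basis_exists[OF assms(1)] by auto
  then have sub: "\<beta> \<subseteq> carrier V" and sp: "V.module.span \<beta> = carrier V"
    and W_li: "W.module.lin_indpt (T ` \<beta>)"
    using inj_lin_indpt[OF assms(3)] by (auto simp: V.basis_def)
  have card: "card (T ` \<beta>) = V.dim"
    using V.dim_basis[OF \<beta>] card_image[OF inj_on_subset[OF assms(3) sub]] by simp
  have TW: "T ` \<beta> \<subseteq> carrier W"
    using sub T_im by auto
  show "V.dim \<le> W.dim"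
    using W.li_le_dim(2)[OF assms(2) TW W_li] card by simp
  assume "W.dim \<le> V.dim"
  then have "W.basis (T ` \<beta>)"
    using W.dim_li_is_basis[OF assms(2) _ TW W_li] \<beta>(1) card by simp
  then show "T ` carrier V = carrier W"
    using image_span[OF sub] sp by (simp add: W.basis_def)
qed

text \<open>By rank-nullity the kernel has dimension 0, so its basis is empty and the kernel is the
  span of the empty set.\<close>

lemma (in linear_map) surj_imp_inj:
  assumes "V.fin_dim" "T ` carrier V = carrier W" "V.dim \<le> W.dim"
  shows "inj_on T (carrier V)"
proof (rule Ke0_imp_inj)
  interpret ker: vectorspace K "V.vs kerT"
    using V.subspace_is_vs[OF kerT_is_subspace] .
  have "imT = carrier W"
    using assms(2) by (simp add: im_def)
  then have "ker.dim = 0"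
    using rank_nullity[OF assms(1)] assms(3) by simp
  obtain \<beta> where \<beta>: "finite \<beta>" "ker.basis \<beta>"
    using ker.finite_basis_exists V.subspace_fin_dim[OF assms(1) kerT_is_subspace] by auto
  then have "\<beta> = {}"
    using ker.dim_basis[OF \<beta>] \<open>ker.dim = 0\<close> by simp
  then show "carrier (V.vs kerT) = {\<zero>\<^bsub>V\<^esub>}"
    using \<beta>(2) ker.span_empty unfolding ker.basis_def by auto
qed

lemma (in linear_map) inv_into_linear:
  assumes "bij_betw T (carrier V) (carrier W)"
  shows "linear_map K W V (inv_into (carrier V) T)"
proof (rule linear_mapI)
  let ?S = "inv_into (carrier V) T"
  have S: "?S y \<in> carrier V" "T (?S y) = y" if "y \<in> carrier W" for y
    using assms that by (auto simp: bij_betw_def inv_into_into f_inv_into_f)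
  have inj: "x = y" if "T x = T y" "x \<in> carrier V" "y \<in> carrier V" for x y
    using assms that by (auto simp: bij_betw_def dest: inj_onD)
  show "?S x \<in> carrier V" if "x \<in> carrier W" for x
    using that by (rule S)
  show "?S (x \<oplus>\<^bsub>W\<^esub> y) = ?S x \<oplus>\<^bsub>V\<^esub> ?S y" if "x \<in> carrier W" "y \<in> carrier W" for x y
    by (rule inj) (use that in \<open>simp_all add: S\<close>)
  show "?S (c \<odot>\<^bsub>W\<^esub> x) = c \<odot>\<^bsub>V\<^esub> ?S x" if "c \<in> carrier K" "x \<in> carrier W" for c x
    by (rule inj) (use that in \<open>simp_all add: S\<close>)
qed (fact V.vectorspace_axioms W.vectorspace_axioms)+

section \<open>Coordinates, and matrices and row vectors of linear maps on column vectors\<close>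

lemma vectorspace_coordinates:
  fixes V :: "('k :: field, 'v, 'z) module_scheme"
  assumes "vectorspace class_ring V" "vectorspace.fin_dim class_ring V"
  obtains e where
    "linear_map class_ring (module_vec TYPE('k) (vectorspace.dim class_ring V)) V e"
    "bij_betw e (carrier_vec (vectorspace.dim class_ring V)) (carrier V)"
proof -
  interpret V: vectorspace class_ring V
    by fact
  let ?n = "V.dim"
  obtain \<beta> where \<beta>: "finite \<beta>" "V.basis \<beta>"
    using V.finite_basis_exists[OF assms(2)] by auto
  then have sub: "\<beta> \<subseteq> carrier V"
    by (auto simp: V.basis_def)
  obtain k where k: "bij_betw k \<beta> {0..<?n}"
    using ex_bij_betw_finite_nat[OF \<beta>(1)] V.dim_basis[OF \<beta>] by auto
  then have k_less: "k b < ?n" if "b \<in> \<beta>" for b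
    using that by (auto simp: bij_betw_def)
  \<comment> \<open>The basis \<beta> is numbered by k, and the coordinate of x at position
    \<open>k b\<close> becomes the coefficient of b.\<close>
  let ?e = "\<lambda>x. V.module.lincomb (\<lambda>b. x $ k b) \<beta>"
  have uniq: "\<exists>!a. a \<in> \<beta> \<rightarrow>\<^sub>E UNIV \<and> V.module.lincomb a \<beta> = v" if "v \<in> carrier V" for v
    using V.basis_criterion[OF \<beta>(1) sub] \<beta>(2) that by simp
  \<comment> \<open>Coordinates are unique only among coefficient functions that are undefined off
    \<beta>; restricting to \<beta> leaves the linear combination unchanged, so uniqueness can be
    applied to \<open>?e\<close>.\<close>
  have restr: "V.module.lincomb (restrict a \<beta>) \<beta> = V.module.lincomb a \<beta>" for a
    using sub by (intro V.module.lincomb_cong) auto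
  have "linear_map class_ring (module_vec TYPE('k) ?n) V ?e"
  proof (rule linear_mapI)
    show "?e x \<in> carrier V" for x
      using sub by auto
    fix x y :: "'k vec" and c :: 'k
    assume x: "x \<in> carrier (module_vec TYPE('k) ?n)"
    then have "?e (c \<cdot>\<^sub>v x) = V.module.lincomb (\<lambda>b. c * x $ k b) \<beta>"
      using sub k_less by (intro V.module.lincomb_cong) (auto simp: module_vec_simps)
    then show "?e (c \<odot>\<^bsub>module_vec TYPE('k) ?n\<^esub> x) = c \<odot>\<^bsub>V\<^esub> ?e x"
      using V.module.lincomb_smult[OF sub, of "\<lambda>b. x $ k b" c] by (simp add: module_vec_simps)
    assume y: "y \<in> carrier (module_vec TYPE('k) ?n)"
    have "?e (x + y) = V.module.lincomb (\<lambda>b. x $ k b + y $ k b) \<beta>"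
      using x y sub k_less by (intro V.module.lincomb_cong) (auto simp: module_vec_simps)
    also have "\<dots> = ?e x \<oplus>\<^bsub>V\<^esub> ?e y"
      using V.module.lincomb_sum[OF \<beta>(1) sub, of "\<lambda>b. x $ k b" "\<lambda>b. y $ k b"] by simp
    finally show "?e (x \<oplus>\<^bsub>module_vec TYPE('k) ?n\<^esub> y) = ?e x \<oplus>\<^bsub>V\<^esub> ?e y"
      by (simp only: module_vec_simps)
  qed (rule vec_vs, rule assms)
  moreover have "bij_betw ?e (carrier_vec ?n) (carrier V)"
  proof (rule bij_betwI')
    fix x y :: "'k vec"
    assume x: "x \<in> carrier_vec ?n" and y: "y \<in> carrier_vec ?n"
    show "?e x = ?e y \<longleftrightarrow> x = y"
    proof
      assume eq: "?e x = ?e y"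
      let ?x = "restrict (\<lambda>b. x $ k b) \<beta>" and ?y = "restrict (\<lambda>b. y $ k b) \<beta>"
      have "?x \<in> \<beta> \<rightarrow>\<^sub>E UNIV" "?y \<in> \<beta> \<rightarrow>\<^sub>E UNIV"
        by simp_all
      moreover have "V.module.lincomb ?x \<beta> = ?e x" "V.module.lincomb ?y \<beta> = ?e x"
        by (simp_all only: restr eq)
      moreover have "?e x \<in> carrier V"
        using sub by auto
      ultimately have "?x = ?y"
        using uniq by blast
      then have eq: "x $ k b = y $ k b" if "b \<in> \<beta>" for b
        using that by (metis restrict_apply')
      show "x = y"
      proof (rule eq_vecI)
        show "x $ i = y $ i" if "i < dim_vec y" for i
        proof -
          have "i \<in> k ` \<beta>"
            using k that y by (auto simp: bij_betw_def)
          then show ?thesis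
            using eq by auto
        qed
      qed (use x y in auto)
    qed simp
  next
    show "?e x \<in> carrier V" for x
      using sub by auto
    fix v assume "v \<in> carrier V"
    then obtain a where a: "V.module.lincomb a \<beta> = v"
      using uniq by blast
    have "?e (vec ?n (\<lambda>i. a (inv_into \<beta> k i))) = V.module.lincomb a \<beta>"
      using sub k k_less
      by (intro V.module.lincomb_cong) (auto simp: bij_betw_def inv_into_f_f)
    then show "\<exists>x\<in>carrier_vec ?n. v = ?e x"
      using a by (intro bexI[of _ "vec ?n (\<lambda>i. a (inv_into \<beta> k i))"]) auto
  qed
  ultimately show thesis
    by (rule that)
qed

lemma zero_smult_vec: "x \<in> carrier_vec n \<Longrightarrow> 0 \<cdot>\<^sub>v x = (0\<^sub>v n :: 'k :: field vec)"
  by (intro eq_vecI) auto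

text \<open>The vectors with property P form a subspace containing the unit vectors. The rule
  reduces identities between linear expressions to unit vectors.\<close>

lemma carrier_vec_induct [consumes 1, case_names zero add smult unit]:
  fixes x :: "'k :: field vec"
  assumes "x \<in> carrier_vec n"
    and "P (0\<^sub>v n)"
    and "\<And>x y. \<lbrakk>x \<in> carrier_vec n; y \<in> carrier_vec n; P x; P y\<rbrakk> \<Longrightarrow> P (x + y)"
    and "\<And>c x. \<lbrakk>x \<in> carrier_vec n; P x\<rbrakk> \<Longrightarrow> P (c \<cdot>\<^sub>v x)"
    and "\<And>i. i < n \<Longrightarrow> P (unit_vec n i)"
  shows "P x"
proof -
  interpret V: vec_space "TYPE('k)" n .
  have "subspace class_ring {x \<in> carrier_vec n. P x} V.V"
    using assms(2-4) by (intro vectorspace.subspaceI[OF vec_vs]) (auto simp: module_vec_simps)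
  then have "V.span (set (unit_vecs n)) \<subseteq> {x \<in> carrier_vec n. P x}"
    using assms(5) by (intro V.span_is_subset) (auto simp: unit_vecs_def V.is_module)
  then show ?thesis
    using assms(1) V.span_unit_vecs_is_carrier by auto
qed

text \<open>Column j of the matrix is the image of the j-th unit vector, so both sides are linear in
  x and agree on unit vectors. The linearity of \<open>L\<close> is assumed only on
  \<open>carrier_vec n\<close>, which is all that the induction meets.\<close>

lemma mat_of_linear:
  fixes L :: "'k :: field vec \<Rightarrow> 'k vec"
  assumes "x \<in> carrier_vec n"
    and "\<And>x. x \<in> carrier_vec n \<Longrightarrow> L x \<in> carrier_vec n"
    and "\<And>x y. \<lbrakk>x \<in> carrier_vec n; y \<in> carrier_vec n\<rbrakk> \<Longrightarrow> L (x + y) = L x + L y"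
    and "\<And>c x. x \<in> carrier_vec n \<Longrightarrow> L (c \<cdot>\<^sub>v x) = c \<cdot>\<^sub>v L x"
  shows "mat n n (\<lambda>(i, j). L (unit_vec n j) $ i) *\<^sub>v x = L x"
  using assms(1)
proof (induction x rule: carrier_vec_induct)
  let ?M = "mat n n (\<lambda>(i, j). L (unit_vec n j) $ i)"
  case zero
  \<comment> \<open>Homogeneity with the scalar 0 gives that \<open>L\<close> sends zero to
    zero.\<close>
  have "L (0 \<cdot>\<^sub>v 0\<^sub>v n) = 0 \<cdot>\<^sub>v L (0\<^sub>v n)"
    by (rule assms(4)) simp
  then have "L (0\<^sub>v n) = 0\<^sub>v n"
    using assms(2)[of "0\<^sub>v n"] by (simp add: zero_smult_vec[of _ n])
  then show ?case
    by (intro eq_vecI) (auto simp: scalar_prod_def)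
next
  case (unit i)
  then show ?case
    using assms(2)[of "unit_vec n i"] by (intro eq_vecI) auto
qed (auto simp: assms(3,4) mult_add_distrib_mat_vec[of _ n n] mult_mat_vec[of _ n n])

lemma functional_eq_scalar_prod:
  fixes f :: "'k :: field vec \<Rightarrow> 'k"
  assumes "x \<in> carrier_vec n"
    and "\<And>x y. \<lbrakk>x \<in> carrier_vec n; y \<in> carrier_vec n\<rbrakk> \<Longrightarrow> f (x + y) = f x + f y"
    and "\<And>c x. x \<in> carrier_vec n \<Longrightarrow> f (c \<cdot>\<^sub>v x) = c * f x"
  shows "f x = vec n (\<lambda>i. f (unit_vec n i)) \<bullet> x"
  using assms(1)
proof (induction x rule: carrier_vec_induct)
  case zero
  show ?case
    using assms(3)[of "0\<^sub>v n" 0] by (simp add: zero_smult_vec[of _ n])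
next
  case (add x y)
  then show ?case
    by (simp add: assms(2) scalar_prod_add_distrib[of _ n])
next
  case (unit i)
  then show ?case
    by (simp add: scalar_prod_right_unit[of i n])
qed (simp add: assms(3))

lemma dual_space_class_ring:
  "dual_space (class_ring :: 'k :: field ring) V = {f \<in> extensional (carrier V).
     (\<forall>x\<in>carrier V. \<forall>y\<in>carrier V. f (x \<oplus>\<^bsub>V\<^esub> y) = f x + f y) \<and>
     (\<forall>c. \<forall>x\<in>carrier V. f (c \<odot>\<^bsub>V\<^esub> x) = c * f x)}"
  by (auto simp: dual_space_def PiE_def)

section \<open>Bilinear pairings and the dual space\<close>

locale pairing = U: vectorspace class_ring U + V: vectorspace class_ring V
  for U :: "('k :: field, 'u, 'y) module_scheme" and V :: "('k, 'v, 'z) module_scheme" +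
  fixes \<omega> :: "'u \<Rightarrow> 'v \<Rightarrow> 'k"
  assumes add_left: "\<lbrakk>u \<in> carrier U; u' \<in> carrier U; v \<in> carrier V\<rbrakk> \<Longrightarrow> \<omega> (u \<oplus>\<^bsub>U\<^esub> u') v
    = \<omega> u v + \<omega> u' v"
    and smult_left: "\<lbrakk>u \<in> carrier U; v \<in> carrier V\<rbrakk> \<Longrightarrow> \<omega> (c \<odot>\<^bsub>U\<^esub> u) v = c * \<omega> u v"
    and add_right: "\<lbrakk>u \<in> carrier U; v \<in> carrier V; v' \<in> carrier V\<rbrakk> \<Longrightarrow> \<omega> u (v \<oplus>\<^bsub>V\<^esub> v')
      = \<omega> u v + \<omega> u v'"
    and smult_right: "\<lbrakk>u \<in> carrier U; v \<in> carrier V\<rbrakk> \<Longrightarrow> \<omega> u (c \<odot>\<^bsub>V\<^esub> v) = c * \<omega> u v"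
begin

text \<open>This is injectivity of the linear map from U to the dual of V that sends u to
  \<open>\<omega> u\<close>. For the pairing \<alpha> (a x) of matrices with vectors it says that
  the stabilizer of \<alpha> is trivial.\<close>

definition left_nondegenerate :: bool where
  "left_nondegenerate \<longleftrightarrow> (\<forall>u \<in> carrier U. (\<forall>v \<in> carrier V. \<omega> u v = 0) \<longrightarrow> u = \<zero>\<^bsub>U\<^esub>)"

text \<open>This is surjectivity of the same map. For the pairing \<alpha> (a x) of matrices with
  vectors it says that the orbit of \<alpha> is open.\<close>

definition represents_dual :: bool where
  "represents_dual \<longleftrightarrow>
     (\<forall>f \<in> dual_space class_ring V. \<exists>u \<in> carrier U. \<forall>v \<in> carrier V. \<omega> u v = f v)"

lemma left_nondegenerateD:
  "\<lbrakk>left_nondegenerate; u \<in> carrier U; \<And>v. v \<in> carrier V \<Longrightarrow> \<omega> u v = 0\<rbrakk> \<Longrightarrow> u = \<zero>\<^bsub>U\<^esub>"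
  by (auto simp: left_nondegenerate_def)

lemma represents_dualE:
  assumes "represents_dual" "f \<in> dual_space class_ring V"
  obtains u where "u \<in> carrier U" "\<And>v. v \<in> carrier V \<Longrightarrow> \<omega> u v = f v"
  using assms by (auto simp: represents_dual_def)

text \<open>In coordinates e on V the functional \<open>\<omega> u\<close> is the scalar product
  with the vector \<open>S u\<close> of its values on the basis. As \<open>dual_space\<close> is a
  mere set, S stands in for the map from U to the dual of V, and dimension arguments for linear maps
  can be applied to it.\<close>

lemma matrix_form:
  assumes "V.fin_dim"
  obtains e S where
    "linear_map class_ring (module_vec TYPE('k) V.dim) V e"
    "bij_betw e (carrier_vec V.dim) (carrier V)"
    "linear_map class_ring U (module_vec TYPE('k) V.dim) S"
    "\<And>u x. \<lbrakk>u \<in> carrier U; x \<in> carrier_vec V.dim\<rbrakk> \<Longrightarrow> \<omega> u (e x) = S u \<bullet> x"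
proof -
  let ?n = "V.dim"
  obtain e where e: "linear_map class_ring (module_vec TYPE('k) ?n) V e"
    and bij: "bij_betw e (carrier_vec ?n) (carrier V)"
    using vectorspace_coordinates[OF V.vectorspace_axioms assms] .
  interpret e: linear_map class_ring "module_vec TYPE('k) ?n" V e
    by fact
  note e_simps = e.T_im[unfolded module_vec_simps] e.T_add[unfolded module_vec_simps]
    e.T_smult[unfolded module_vec_simps]
  let ?S = "\<lambda>u. vec ?n (\<lambda>i. \<omega> u (e (unit_vec ?n i)))"
  have "linear_map class_ring U (module_vec TYPE('k) ?n) ?S"
    by (rule linear_mapI)
      (auto simp: module_vec_simps U.vectorspace_axioms vec_vs add_left smult_left e_simps)
  moreover have "\<omega> u (e x) = ?S u \<bullet> x" if "u \<in> carrier U" "x \<in> carrier_vec ?n" for u x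
    using that by (intro functional_eq_scalar_prod) (simp_all add: e_simps add_right smult_right)
  ultimately show thesis
    using that e bij by blast
qed

text \<open>Nondegeneracy makes S injective, which bounds the dimension of U. If the dimensions
  agree, S is onto, so the vector of values of any functional on the basis has the form
  \<open>S u\<close>.\<close>

lemma left_nondegenerate_dim_le:
  assumes "U.fin_dim" "V.fin_dim" left_nondegenerate
  shows "U.dim \<le> V.dim"
    and "V.dim \<le> U.dim \<Longrightarrow> represents_dual"
proof -
  let ?n = "V.dim"
  obtain e S where e: "linear_map class_ring (module_vec TYPE('k) ?n) V e"
    and bij: "bij_betw e (carrier_vec ?n) (carrier V)"
    and S: "linear_map class_ring U (module_vec TYPE('k) ?n) S"
    and \<omega>: "\<And>u x. \<lbrakk>u \<in> carrier U; x \<in> carrier_vec ?n\<rbrakk> \<Longrightarrow> \<omega> u (e x) = S u \<bullet> x"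
    using matrix_form[OF assms(2)] by blast
  interpret e: linear_map class_ring "module_vec TYPE('k) ?n" V e
    by fact
  interpret S: linear_map class_ring U "module_vec TYPE('k) ?n" S
    by fact
  interpret K: vec_space "TYPE('k)" ?n .
  have surj: "\<exists>x\<in>carrier_vec ?n. v = e x" if "v \<in> carrier V" for v
    using bij that by (auto simp: bij_betw_def)
  have "u = \<zero>\<^bsub>U\<^esub>" if "u \<in> carrier U" "S u = 0\<^sub>v ?n" for u
    using assms(3) that(1)
  proof (rule left_nondegenerateD)
    show "\<omega> u v = 0" if "v \<in> carrier V" for v
      using surj[OF that] \<omega> \<open>u \<in> carrier U\<close> \<open>S u = 0\<^sub>v ?n\<close> by auto
  qed
  then have inj: "inj_on S (carrier U)"
    using S.T0_is_0 by (intro S.Ke0_imp_inj) (auto simp: S.ker_def module_vec_simps)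
  show "U.dim \<le> V.dim"
    using S.inj_dim_le(1)[OF assms(1) K.fin_dim inj] by (simp add: K.dim_is_n)
  assume "V.dim \<le> U.dim"
  then have S_surj: "S ` carrier U = carrier_vec ?n"
    using S.inj_dim_le(2)[OF assms(1) K.fin_dim inj] by (simp add: K.dim_is_n module_vec_simps)
  show represents_dual
    unfolding represents_dual_def
  proof
    fix f assume f: "f \<in> dual_space class_ring V"
    have "vec ?n (\<lambda>i. f (e (unit_vec ?n i))) \<in> S ` carrier U"
      by (simp add: S_surj)
    then obtain u where u: "u \<in> carrier U" "S u = vec ?n (\<lambda>i. f (e (unit_vec ?n i)))"
      by auto
    have "f (e x) = S u \<bullet> x" if "x \<in> carrier_vec ?n" for x
      unfolding u(2) using that f
      by (intro functional_eq_scalar_prod)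
        (simp_all add: dual_space_class_ring e.T_im[unfolded module_vec_simps]
          e.T_add[unfolded module_vec_simps] e.T_smult[unfolded module_vec_simps])
    then have "\<forall>v\<in>carrier V. \<omega> u v = f v"
      using surj \<omega>[OF u(1)] by metis
    then show "\<exists>u\<in>carrier U. \<forall>v\<in>carrier V. \<omega> u v = f v"
      using u(1) by blast
  qed
qed

text \<open>If every functional is represented, S is onto; as U is no larger than V, S is then
  injective.\<close>

lemma represents_dual_imp_left_nondegenerate:
  assumes "U.fin_dim" "V.fin_dim" "U.dim \<le> V.dim" represents_dual
  shows left_nondegenerate
proof -
  let ?n = "V.dim"
  obtain e S where e: "linear_map class_ring (module_vec TYPE('k) ?n) V e"
    and bij: "bij_betw e (carrier_vec ?n) (carrier V)"
    and S: "linear_map class_ring U (module_vec TYPE('k) ?n) S"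
    and \<omega>: "\<And>u x. \<lbrakk>u \<in> carrier U; x \<in> carrier_vec ?n\<rbrakk> \<Longrightarrow> \<omega> u (e x) = S u \<bullet> x"
    using matrix_form[OF assms(2)] by blast
  interpret e: linear_map class_ring "module_vec TYPE('k) ?n" V e
    by fact
  interpret S: linear_map class_ring U "module_vec TYPE('k) ?n" S
    by fact
  interpret K: vec_space "TYPE('k)" ?n .
  let ?d = "inv_into (carrier_vec ?n) e"
  have "linear_map class_ring V (module_vec TYPE('k) ?n) ?d"
    using e.inv_into_linear bij by (simp add: module_vec_simps)
  then interpret d: linear_map class_ring V "module_vec TYPE('k) ?n" ?d .
  note d_simps = d.T_im[unfolded module_vec_simps] d.T_add[unfolded module_vec_simps]
    d.T_smult[unfolded module_vec_simps]
  have e_im: "e x \<in> carrier V" if "x \<in> carrier_vec ?n" for x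
    using bij that by (auto simp: bij_betw_def)
  have "S ` carrier U = carrier_vec ?n"
  proof
    show "S ` carrier U \<subseteq> carrier_vec ?n"
      using S.T_im by (auto simp: module_vec_simps)
    show "carrier_vec ?n \<subseteq> S ` carrier U"
    proof
      fix c :: "'k vec" assume c: "c \<in> carrier_vec ?n"
      \<comment> \<open>The functional with coordinate vector c. Testing an element u that
        represents it on the unit vectors yields \<open>S u = c\<close>.\<close>
      let ?f = "\<lambda>v\<in>carrier V. c \<bullet> ?d v"
      have "?f \<in> dual_space class_ring V"
        using c by (auto simp: dual_space_class_ring d_simps scalar_prod_add_distrib[of _ ?n])
      then obtain u where u: "u \<in> carrier U" "\<And>v. v \<in> carrier V \<Longrightarrow> \<omega> u v = ?f v"
        using represents_dualE[OF assms(4)] by blast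
      have Su: "S u \<in> carrier_vec ?n"
        using S.T_im[OF u(1)] by (simp add: module_vec_simps)
      have "S u $ i = c $ i" if "i < ?n" for i
      proof -
        have "S u \<bullet> unit_vec ?n i = \<omega> u (e (unit_vec ?n i))"
          using \<omega>[OF u(1)] by simp
        also have "\<dots> = c \<bullet> unit_vec ?n i"
          using bij by (simp add: u(2) e_im bij_betw_def inv_into_f_f)
        finally show ?thesis
          using that Su c by simp
      qed
      then have "S u = c"
        using Su c by (intro eq_vecI) auto
      then show "c \<in> S ` carrier U"
        using u(1) by blast
    qed
  qed
  then have inj: "inj_on S (carrier U)"
    using assms(1,3) by (intro S.surj_imp_inj) (simp_all add: module_vec_simps K.dim_is_n)
  show ?thesis
    unfolding left_nondegenerate_def
  proof (intro ballI impI)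
    fix u assume u: "u \<in> carrier U" and z: "\<forall>v\<in>carrier V. \<omega> u v = 0"
    have Su: "S u \<in> carrier_vec ?n"
      using S.T_im[OF u] by (simp add: module_vec_simps)
    have "S u $ i = 0" if "i < ?n" for i
    proof -
      have "S u \<bullet> unit_vec ?n i = 0"
        using \<omega>[OF u, of "unit_vec ?n i"] z e_im by simp
      then show ?thesis
        using that Su by simp
    qed
    then have "S u = 0\<^sub>v ?n"
      using Su by (intro eq_vecI) auto
    then show "u = \<zero>\<^bsub>U\<^esub>"
      using S.T0_is_0 inj_onD[OF inj, of u "\<zero>\<^bsub>U\<^esub>"] u by (simp add: module_vec_simps)
  qed
qed

end

section \<open>Semidirect products with an open orbit\<close>

lemma mat_smult_mult_vec:
  assumes "a \<in> carrier_mat n n" "x \<in> carrier_vec n"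
  shows "(c \<cdot>\<^sub>m a) *\<^sub>v x = (c :: 'k :: field) \<cdot>\<^sub>v (a *\<^sub>v x)"
  using assms by (intro eq_vecI) auto

lemma zero_mat_mult_vec: "x \<in> carrier_vec n \<Longrightarrow> 0\<^sub>m m n *\<^sub>v x = (0\<^sub>v m :: 'k :: field vec)"
  by (intro eq_vecI) auto

lemma commuting_mat_mult_vec:
  fixes a b :: "'k :: field mat"
  assumes "a \<in> carrier_mat n n" "b \<in> carrier_mat n n" "x \<in> carrier_vec n" "a * b = b * a"
  shows "a *\<^sub>v (b *\<^sub>v x) = b *\<^sub>v (a *\<^sub>v x)"
  using assms by (metis assoc_mult_mat_vec)

lemma mat_subspace_closed:
  assumes "subspace class_ring B (module_mat TYPE('k :: field) n n)"
  shows "B \<subseteq> carrier_mat n n" "0\<^sub>m n n \<in> B"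
    and "\<lbrakk>a \<in> B; b \<in> B\<rbrakk> \<Longrightarrow> a + b \<in> B"
    and "a \<in> B \<Longrightarrow> c \<cdot>\<^sub>m a \<in> B"
    and "a \<in> B \<Longrightarrow> a *\<^sub>v x \<in> carrier_vec n"
proof -
  show B: "B \<subseteq> carrier_mat n n" "0\<^sub>m n n \<in> B"
    and "\<lbrakk>a \<in> B; b \<in> B\<rbrakk> \<Longrightarrow> a + b \<in> B" and "a \<in> B \<Longrightarrow> c \<cdot>\<^sub>m a \<in> B"
    using assms by (auto simp: subspace_def submodule_def module_mat_simps)
  show "a *\<^sub>v x \<in> carrier_vec n" if "a \<in> B"
  proof (rule carrier_vecI)
    have "dim_row a = n"
      using B(1) that by auto
    then show "dim_vec (a *\<^sub>v x) = n"
      by (simp only: dim_mult_mat_vec)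
  qed
qed

lemma semidirect_vectorspace:
  assumes "subspace class_ring B (module_mat TYPE('k :: field) n n)"
  shows "vectorspace (class_ring :: 'k ring) (semidirect n B)"
proof -
  let ?D = "direct_sum ((module_mat TYPE('k) n n)\<lparr>carrier := B\<rparr>) (module_vec TYPE('k) n)"
  interpret D: vectorspace "class_ring :: 'k ring" ?D
    using assms by (intro direct_sum_is_vs vectorspace.subspace_is_vs matrix_vs vec_vs)
  \<comment> \<open>The record differs from the direct sum only in the added bracket field, so the
    vector space axioms carry over from \<open>?D\<close>.\<close>
  have eq: "carrier (semidirect n B) = carrier ?D" "\<zero>\<^bsub>semidirect n B\<^esub> = \<zero>\<^bsub>?D\<^esub>"
    "add (semidirect n B) = add ?D" "module.smult (semidirect n B) = module.smult ?D"
    by (simp_all add: semidirect_def module.extend_def lie_structure.fields_def)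
  have "\<exists>w\<in>carrier ?D. v \<oplus>\<^bsub>?D\<^esub> w = \<zero>\<^bsub>?D\<^esub>" if "v \<in> carrier ?D" for v
    using that by (intro bexI[of _ "\<ominus>\<^bsub>?D\<^esub> v"] D.M.r_neg) simp_all
  then show ?thesis
    by (intro vs_criteria)
      (simp_all add: eq class_field D.M.a_ac D.smult_assoc1[simplified] D.smult_one[simplified]
          D.smult_l_distr[simplified]
        D.smult_r_distr[simplified] D.smult_closed[simplified])
qed

text \<open>Every axiom but the Jacobi identity is linearity of the matrix action. The nested
  bracket of (a, x), (b, y), (c, z) has second component a b z - a c y, and the cyclic sum of these
  cancels because the matrices commute.\<close>

lemma semidirect_lie_algebra:
  fixes B :: "'k :: field mat set"
  assumes "subspace class_ring B (module_mat TYPE('k) n n)"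
    and "\<And>a b. \<lbrakk>a \<in> B; b \<in> B\<rbrakk> \<Longrightarrow> a * b = b * a"
  shows "lie_algebra class_ring (semidirect n B)"
proof -
  interpret vectorspace "class_ring :: 'k ring" "semidirect n B"
    using assms(1) by (rule semidirect_vectorspace)
  note B = mat_subspace_closed[OF assms(1)]
  have B_mat: "a \<in> carrier_mat n n" "dim_row a = n" "dim_col a = n" if "a \<in> B" for a
    using that B(1) by auto
  have comm: "a *\<^sub>v (b *\<^sub>v x) = b *\<^sub>v (a *\<^sub>v x)" if "a \<in> B" "b \<in> B" "x \<in> carrier_vec n" for a b x
    using that B_mat(1) assms(2) by (intro commuting_mat_mult_vec)
  show ?thesis
  \<comment> \<open>The goals come in the order of the axioms of \<open>lie_algebra\<close>:
    closure, the two additivities, the two homogeneities, the alternating law, Jacobi.\<close>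
  proof (unfold_locales, goal_cases)
    case 1
    then show ?case
      using B(2,5) by (auto simp: semidirect_simps)
  next
    case 2
    then show ?case
      using B_mat
      by (auto simp: semidirect_simps add_mult_distrib_mat_vec[of _ n n]
          mult_add_distrib_mat_vec[of _ n n] intro!: eq_vecI)
  next
    case 3
    then show ?case
      using B_mat
      by (auto simp: semidirect_simps add_mult_distrib_mat_vec[of _ n n]
          mult_add_distrib_mat_vec[of _ n n] intro!: eq_vecI)
  next
    case 4
    then show ?case
      using B_mat
      by (auto simp: semidirect_simps mat_smult_mult_vec[of _ n] mult_mat_vec[of _ n n]
          algebra_simps intro!: eq_vecI)
  next
    case 5
    then show ?case
      using B_mat
      by (auto simp: semidirect_simps mat_smult_mult_vec[of _ n] mult_mat_vec[of _ n n]
          algebra_simps intro!: eq_vecI)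
  next
    case 6
    then show ?case
      using B_mat by (auto simp: semidirect_simps intro!: eq_vecI)
  next
    case (7 u v w)
    then obtain a x b y c z where "u = (a, x)" "v = (b, y)" "w = (c, z)"
      and mem: "a \<in> B" "b \<in> B" "c \<in> B" "x \<in> carrier_vec n" "y \<in> carrier_vec n" "z \<in> carrier_vec n"
      by (auto simp: semidirect_simps)
    moreover have "p *\<^sub>v (q *\<^sub>v s - r *\<^sub>v t) = p *\<^sub>v (q *\<^sub>v s) - p *\<^sub>v (r *\<^sub>v t)"
      if "p \<in> B" "q \<in> B" "r \<in> B" for p q r s t
      using that B(5) B_mat(1) by (intro mult_minus_distrib_mat_vec)
    moreover have "b *\<^sub>v (a *\<^sub>v z) = a *\<^sub>v (b *\<^sub>v z)" "c *\<^sub>v (a *\<^sub>v y) = a *\<^sub>v (c *\<^sub>v y)"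
      "c *\<^sub>v (b *\<^sub>v x) = b *\<^sub>v (c *\<^sub>v x)"
      using mem comm by blast+
    ultimately show ?case
      using B_mat by (auto simp: semidirect_simps intro!: eq_vecI)
  qed
qed

lemma semidirect_fin_dim:
  fixes B :: "'k :: field mat set"
  assumes "subspace class_ring B (module_mat TYPE('k) n n)"
    and "vectorspace.fin_dim class_ring ((module_mat TYPE('k) n n)\<lparr>carrier := B\<rparr>)"
  shows "vectorspace.fin_dim class_ring (semidirect n B)"
proof -
  interpret S: vectorspace "class_ring :: 'k ring" "semidirect n B"
    using assms(1) by (rule semidirect_vectorspace)
  interpret M: vectorspace "class_ring :: 'k ring" "(module_mat TYPE('k) n n)\<lparr>carrier := B\<rparr>"
    using assms(1) by (intro vectorspace.subspace_is_vs matrix_vs)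
  interpret K: vec_space "TYPE('k)" n .
  note B = mat_subspace_closed[OF assms(1)]
  have i1: "linear_map class_ring ((module_mat TYPE('k) n n)\<lparr>carrier := B\<rparr>) (semidirect n B)
      (\<lambda>a. (a, 0\<^sub>v n))"
    by (rule linear_mapI)
      (auto simp: semidirect_simps module_mat_simps M.vectorspace_axioms S.vectorspace_axioms)
  have i2: "linear_map class_ring (module_vec TYPE('k) n) (semidirect n B) (\<lambda>x. (0\<^sub>m n n, x))"
    using B by (intro linear_mapI)
      (auto simp: semidirect_simps module_vec_simps vec_vs S.vectorspace_axioms)
  obtain \<beta> where \<beta>: "finite \<beta>" "\<beta> \<subseteq> B" "M.module.span \<beta> = B"
    using assms(2) unfolding M.fin_dim_def by auto
  \<comment> \<open>A finite spanning set: a finite spanning set of B in the first factor together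
    with the unit vectors in the second.\<close>
  let ?X = "(\<lambda>a. (a, 0\<^sub>v n)) ` \<beta>" and ?Y = "(\<lambda>x. (0\<^sub>m n n, x)) ` set (unit_vecs n)"
  have sub: "?X \<union> ?Y \<subseteq> carrier (semidirect n B)"
    using \<beta> B by (auto simp: semidirect_simps unit_vecs_def)
  have X: "(\<lambda>a. (a, 0\<^sub>v n)) ` B = S.span ?X"
    using linear_map.image_span[OF i1, of \<beta>] \<beta> by simp
  have Y: "(\<lambda>x. (0\<^sub>m n n, x)) ` carrier_vec n = S.span ?Y"
    using linear_map.image_span[OF i2, of "set (unit_vecs n)"] K.span_unit_vecs_is_carrier
    by (simp add: module_vec_simps unit_vecs_carrier)
  have "carrier (semidirect n B) \<subseteq> S.span (?X \<union> ?Y)"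
  proof
    fix v assume "v \<in> carrier (semidirect n B)"
    then obtain a x where v: "v = (a, x)" "a \<in> B" "x \<in> carrier_vec n"
      by (auto simp: semidirect_simps)
    then have "v = (a, 0\<^sub>v n) \<oplus>\<^bsub>semidirect n B\<^esub> (0\<^sub>m n n, x)"
      using B by (auto simp: semidirect_simps)
    moreover have "(a, 0\<^sub>v n) \<in> S.span (?X \<union> ?Y)"
      using v(2) X S.span_is_monotone[of ?X "?X \<union> ?Y"] by auto
    moreover have "(0\<^sub>m n n, x) \<in> S.span (?X \<union> ?Y)"
      using v(3) Y S.span_is_monotone[of ?Y "?X \<union> ?Y"] by auto
    ultimately show "v \<in> S.span (?X \<union> ?Y)"
      using submodule.m_closed[OF S.span_is_submodule[OF sub]] by simp
  qed
  then show ?thesis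
    using sub \<beta>(1) S.span_is_subset2[OF sub] unfolding S.fin_dim_def
    by (intro exI[of _ "?X \<union> ?Y"]) auto
qed

text \<open>All brackets have matrix component zero, so the derived ideal lies in the copy of the
  vector space, on which the bracket vanishes.\<close>

lemma semidirect_two_step_solvable:
  fixes B :: "'k :: field mat set"
  assumes "subspace class_ring B (module_mat TYPE('k) n n)"
    and "\<And>a b. \<lbrakk>a \<in> B; b \<in> B\<rbrakk> \<Longrightarrow> a * b = b * a"
  shows "lie_algebra.two_step_solvable class_ring (semidirect n B)"
proof -
  interpret lie_algebra "class_ring :: 'k ring" "semidirect n B"
    using assms by (rule semidirect_lie_algebra)
  note B = mat_subspace_closed[OF assms(1)]
  have "subspace class_ring ({0\<^sub>m n n} \<times> carrier_vec n) (semidirect n B)"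
    using B by (intro subspaceI) (auto simp: semidirect_simps)
  moreover have "a *\<^sub>v y - b *\<^sub>v x \<in> carrier_vec n"
    if "a \<in> B" "b \<in> B" "x \<in> carrier_vec n" "y \<in> carrier_vec n" for a b x y
    using that B(1) by (intro minus_carrier_vec mult_mat_vec_carrier) auto
  ultimately have "derived_ideal \<subseteq> {0\<^sub>m n n} \<times> carrier_vec n"
    unfolding derived_ideal_def
    by (intro span_is_subset) (auto simp: semidirect_simps is_module)
  moreover have "lie_bracket (semidirect n B) u v = \<zero>\<^bsub>semidirect n B\<^esub>"
    if "u \<in> {0\<^sub>m n n} \<times> carrier_vec n" "v \<in> {0\<^sub>m n n} \<times> carrier_vec n" for u v
    using that by (auto simp: semidirect_simps intro!: eq_vecI)
  ultimately show ?thesis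
    unfolding two_step_solvable_def by blast
qed

lemma dual_space_vec_diff:
  fixes f :: "'k :: field vec \<Rightarrow> 'k"
  assumes "f \<in> dual_space class_ring (module_vec TYPE('k) n)" "x \<in> carrier_vec n"
    "y \<in> carrier_vec n"
  shows "f (x - y) = f x - f y"
proof -
  have "x - y = x + (- 1) \<cdot>\<^sub>v y"
    using assms(2,3) by (intro eq_vecI) auto
  then have "f (x - y) = f x + - 1 * f y"
    using assms by (simp add: dual_space_class_ring module_vec_simps)
  then show ?thesis
    by simp
qed

text \<open>The commutant of any set of matrices is a subspace. Applied to A, this shows that the
  span commutes with A; then A lies in the commutant of the span, and a second application puts the
  whole span there.\<close>

lemma mat_span_commute:
  fixes A :: "'k :: field mat set"
  assumes "A \<subseteq> carrier_mat n n" "\<And>a b. \<lbrakk>a \<in> A; b \<in> A\<rbrakk> \<Longrightarrow> a * b = b * a"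
    and "a \<in> mat_span n A" "b \<in> mat_span n A"
  shows "a * b = b * a"
proof -
  interpret M: vectorspace "class_ring :: 'k ring" "module_mat TYPE('k) n n"
    by (rule matrix_vs)
  have sub: "subspace class_ring {a \<in> carrier_mat n n. \<forall>b\<in>S. a * b = b * a}
      (module_mat TYPE('k) n n)"
    if "S \<subseteq> carrier_mat n n" for S
    using that
    by (intro M.subspaceI) (auto simp: module_mat_simps add_mult_distrib_mat[of _ n n]
      mult_add_distrib_mat[of _ n n] mult_smult_assoc_mat[of _ n n] mult_smult_distrib[of _ n n]
      subset_iff)
  have span: "mat_span n A \<subseteq> {a \<in> carrier_mat n n. \<forall>b\<in>S. a * b = b * a}"
    if "S \<subseteq> carrier_mat n n" "\<forall>a\<in>A. \<forall>b\<in>S. a * b = b * a" for S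
    unfolding mat_span_def using that assms(1) sub[of S]
    by (intro M.span_is_subset) (auto simp: M.is_module)
  have *: "mat_span n A \<subseteq> {a \<in> carrier_mat n n. \<forall>b\<in>A. a * b = b * a}"
    using assms(1,2) by (intro span) auto
  then have "mat_span n A \<subseteq> {a \<in> carrier_mat n n. \<forall>b\<in>mat_span n A. a * b = b * a}"
    by (intro span) fastforce+
  then show ?thesis
    using assms(3,4) by auto
qed

text \<open>If (a, x) lies in the radical of the form, then \<alpha> (a y) = \<alpha> (b x) for all
  b in B and all y. Taking b = 0 puts a in the stabilizer of \<alpha>, so a = 0; taking y = 0 shows
  that \<alpha> (b x) vanishes for all b, and the open orbit then forces x = 0.\<close>

lemma semidirect_frobenius_functional:
  fixes B :: "'k :: field mat set"
  assumes "subspace class_ring B (module_mat TYPE('k) n n)"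
    and "\<And>a b. \<lbrakk>a \<in> B; b \<in> B\<rbrakk> \<Longrightarrow> a * b = b * a"
    and \<alpha>: "\<alpha> \<in> dual_space class_ring (module_vec TYPE('k) n)"
    and orbit: "\<And>f. f \<in> dual_space class_ring (module_vec TYPE('k) n) \<Longrightarrow>
      \<exists>b\<in>B. \<forall>x\<in>carrier_vec n. \<alpha> (b *\<^sub>v x) = f x"
    and stabilizer: "\<And>a. \<lbrakk>a \<in> B; \<And>x. x \<in> carrier_vec n \<Longrightarrow> \<alpha> (a *\<^sub>v x) = 0\<rbrakk> \<Longrightarrow> a = 0\<^sub>m n n"
  shows "lie_algebra.frobenius_functional class_ring (semidirect n B)
    (\<lambda>u\<in>B \<times> carrier_vec n. \<alpha> (snd u))"
proof -
  interpret lie_algebra "class_ring :: 'k ring" "semidirect n B"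
    using assms(1,2) by (rule semidirect_lie_algebra)
  note B = mat_subspace_closed[OF assms(1)]
  let ?F = "\<lambda>u\<in>B \<times> carrier_vec n. \<alpha> (snd u)"
  have F: "?F \<in> dual_space class_ring (semidirect n B)"
    using \<alpha> B by (auto simp: dual_space_class_ring semidirect_simps module_vec_simps)
  have cob: "coboundary ?F (a, x) (b, y) = - (\<alpha> (a *\<^sub>v y) - \<alpha> (b *\<^sub>v x))"
    if "a \<in> B" "b \<in> B" "x \<in> carrier_vec n" "y \<in> carrier_vec n" for a b x y
  proof -
    have "a *\<^sub>v y - b *\<^sub>v x \<in> carrier_vec n"
      using B(5) that by (intro minus_carrier_vec)
    then show ?thesis
      using that B dual_space_vec_diff[OF \<alpha>]
      by (simp add: coboundary_def semidirect_simps class_ring_simps)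
  qed
  have "u = \<zero>\<^bsub>semidirect n B\<^esub>"
    if u: "u \<in> carrier (semidirect n B)"
      and z: "\<And>v. v \<in> carrier (semidirect n B) \<Longrightarrow> coboundary ?F u v = 0" for u
  proof -
    obtain a x where ax: "u = (a, x)" "a \<in> B" "x \<in> carrier_vec n"
      using u by (auto simp: semidirect_simps)
    have \<alpha>0: "\<alpha> (0\<^sub>v n) = 0"
      using dual_space_vec_diff[OF \<alpha>, of "0\<^sub>v n" "0\<^sub>v n"] by simp
    have rel: "\<alpha> (a *\<^sub>v y) = \<alpha> (b *\<^sub>v x)" if "b \<in> B" "y \<in> carrier_vec n" for b y
      using z[of "(b, y)"] cob[OF ax(2) that(1) ax(3) that(2)] that ax(1)
      by (simp add: semidirect_simps)
    have "a = 0\<^sub>m n n"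
    proof (rule stabilizer[OF ax(2)])
      show "\<alpha> (a *\<^sub>v y) = 0" if "y \<in> carrier_vec n" for y
        using rel[OF B(2) that] ax(3) \<alpha>0 by (simp add: zero_mat_mult_vec)
    qed
    moreover have "x $ i = 0" if "i < n" for i
    proof -
      \<comment> \<open>The i-th coordinate functional is \<alpha> composed with some b in B; for
        this b the relation with y = 0 reads off entry i of x.\<close>
      have "(\<lambda>y\<in>carrier_vec n. y $ i) \<in> dual_space class_ring (module_vec TYPE('k) n)"
        using that by (auto simp: dual_space_class_ring module_vec_simps)
      then obtain b where b: "b \<in> B" "\<And>y. y \<in> carrier_vec n \<Longrightarrow> \<alpha> (b *\<^sub>v y) = y $ i"
        using orbit by fastforce
      then have "x $ i = \<alpha> (a *\<^sub>v 0\<^sub>v n)"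
        using rel[OF b(1), of "0\<^sub>v n"] ax(3) by simp
      also have "\<dots> = 0"
        using rel[OF B(2), of "0\<^sub>v n"] ax(3) \<alpha>0 by (simp add: zero_mat_mult_vec)
      finally show ?thesis .
    qed
    ultimately show ?thesis
      using ax by (auto simp: semidirect_simps intro!: eq_vecI)
  qed
  then show ?thesis
    using F by (simp add: frobenius_functional_def)
qed

text \<open>The set A is a basis of its span, which therefore has dimension n. The open orbit says
  that the pairing \<alpha> (a x) represents the dual, and equality of dimensions turns this into a
  trivial stabilizer.\<close>

lemma semidirect_two_step_solvable_frobenius:
  fixes A :: "'k :: field mat set"
  assumes "commuting_open_orbit_generators n A"
  shows "two_step_solvable_frobenius_lie_algebra class_ring (semidirect n (mat_span n A))"
proof -
  interpret M: vectorspace "class_ring :: 'k ring" "module_mat TYPE('k) n n"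
    by (rule matrix_vs)
  interpret K: vec_space "TYPE('k)" n .
  have A: "finite A" "card A = n" "A \<subseteq> carrier_mat n n" "M.module.lin_indpt A"
    and A_comm: "\<And>a b. \<lbrakk>a \<in> A; b \<in> A\<rbrakk> \<Longrightarrow> a * b = b * a"
    and open_orbit: "has_open_orbit n (mat_span n A)"
    using assms by (auto simp: commuting_open_orbit_generators_def)
  let ?B = "mat_span n A"
  let ?MB = "(module_mat TYPE('k) n n)\<lparr>carrier := ?B\<rparr>"
  have sub: "subspace class_ring ?B (module_mat TYPE('k) n n)"
    unfolding mat_span_def using A(3) by (intro M.span_is_subspace) (simp add: module_mat_simps)
  note B = mat_subspace_closed[OF sub]
  have comm: "a * b = b * a" if "a \<in> ?B" "b \<in> ?B" for a b
    using A(3) A_comm that by (rule mat_span_commute)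
  interpret B: vectorspace "class_ring :: 'k ring" ?MB
    using sub by (rule M.subspace_is_vs)
  have AB: "A \<subseteq> ?B"
    unfolding mat_span_def using A(3) by (intro M.in_own_span) (simp add: module_mat_simps)
  have "B.basis A"
    unfolding B.basis_def
    using M.span_li_not_depend[OF AB M.is_module[OF sub]] A(4) AB by (simp add: mat_span_def)
  then have fd: "B.fin_dim" and dim: "B.dim = n"
    using A(1,2) B.dim_basis unfolding B.fin_dim_def B.basis_def by auto
  obtain \<alpha> where \<alpha>: "\<alpha> \<in> dual_space class_ring (module_vec TYPE('k) n)"
    and orbit: "{dual_action n a \<alpha> | a. a \<in> ?B} = dual_space class_ring (module_vec TYPE('k) n)"
    using open_orbit by (auto simp: has_open_orbit_def)
  interpret P: pairing ?MB "module_vec TYPE('k) n" "\<lambda>a x. \<alpha> (a *\<^sub>v x)"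
  proof
    fix a b :: "'k mat" and x y :: "'k vec" and c :: 'k
    assume "a \<in> carrier ?MB" and x: "x \<in> carrier (module_vec TYPE('k) n)"
    then have a: "a \<in> ?B" "a \<in> carrier_mat n n"
      using B(1) by auto
    show "\<alpha> ((c \<odot>\<^bsub>?MB\<^esub> a) *\<^sub>v x) = c * \<alpha> (a *\<^sub>v x)"
      using a x \<alpha> B(5)
      by (simp add: module_vec_simps module_mat_simps mat_smult_mult_vec[of _ n]
          dual_space_class_ring)
    show "\<alpha> (a *\<^sub>v (c \<odot>\<^bsub>module_vec TYPE('k) n\<^esub> x)) = c * \<alpha> (a *\<^sub>v x)"
      using a x \<alpha> B(5)
      by (simp add: module_vec_simps mult_mat_vec[of _ n n] dual_space_class_ring)
    show "\<alpha> (a *\<^sub>v (x \<oplus>\<^bsub>module_vec TYPE('k) n\<^esub> y)) = \<alpha> (a *\<^sub>v x) + \<alpha> (a *\<^sub>v y)"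
      if "y \<in> carrier (module_vec TYPE('k) n)"
      using a x \<alpha> B(5) that
      by (simp add: module_vec_simps mult_add_distrib_mat_vec[of _ n n] dual_space_class_ring)
    assume "b \<in> carrier ?MB"
    then have b: "b \<in> ?B" "b \<in> carrier_mat n n"
      using B(1) by auto
    show "\<alpha> ((a \<oplus>\<^bsub>?MB\<^esub> b) *\<^sub>v x) = \<alpha> (a *\<^sub>v x) + \<alpha> (b *\<^sub>v x)"
      using a b x \<alpha> B(5)
      by (simp add: module_vec_simps module_mat_simps add_mult_distrib_mat_vec[of _ n n]
          dual_space_class_ring)
  qed
  have repr: "\<exists>b\<in>?B. \<forall>x\<in>carrier_vec n. \<alpha> (b *\<^sub>v x) = f x"
    if f: "f \<in> dual_space class_ring (module_vec TYPE('k) n)" for f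
  proof -
    \<comment> \<open>The action carries a minus sign, so the orbit is asked for the negative of
      f.\<close>
    have "(\<lambda>x\<in>carrier_vec n. - f x) \<in> dual_space class_ring (module_vec TYPE('k) n)"
      using f by (auto simp: dual_space_class_ring module_vec_simps)
    then have "(\<lambda>x\<in>carrier_vec n. - f x) \<in> {dual_action n a \<alpha> | a. a \<in> ?B}"
      by (simp only: orbit)
    then obtain b where b: "b \<in> ?B" "(\<lambda>x\<in>carrier_vec n. - f x) = dual_action n b \<alpha>"
      by (elim CollectE exE conjE)
    have "- f x = - \<alpha> (b *\<^sub>v x)" if "x \<in> carrier_vec n" for x
      using that fun_cong[OF b(2), of x] by (simp add: dual_action_def)
    then show ?thesis
      using b(1) by auto
  qed
  have P_repr: "P.represents_dual"
    using repr by (simp add: P.represents_dual_def module_vec_simps)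
  have "P.left_nondegenerate"
    using P.represents_dual_imp_left_nondegenerate[OF fd K.fin_dim _ P_repr]
    by (simp add: dim K.dim_is_n)
  then have stab: "a = 0\<^sub>m n n" if "a \<in> ?B" "\<And>x. x \<in> carrier_vec n \<Longrightarrow> \<alpha> (a *\<^sub>v x) = 0" for a
    using that P.left_nondegenerateD[of a] by (simp add: module_vec_simps module_mat_simps)
  have lie: "lie_algebra class_ring (semidirect n ?B)"
    using sub comm by (rule semidirect_lie_algebra)
  have "lie_algebra.frobenius class_ring (semidirect n ?B)"
    using semidirect_frobenius_functional[OF sub comm \<alpha> repr stab]
    unfolding lie_algebra.frobenius_def[OF lie] by blast
  moreover have "lie_algebra.two_step_solvable class_ring (semidirect n ?B)"
    using sub comm by (rule semidirect_two_step_solvable)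
  moreover have "fin_dim_lie_algebra class_ring (semidirect n ?B)"
    using lie semidirect_fin_dim[OF sub fd]
    by (simp add: fin_dim_lie_algebra_def fin_dim_lie_algebra_axioms_def)
  ultimately show ?thesis
    by (simp add: two_step_solvable_frobenius_lie_algebra_def)
qed

section \<open>The splitting of a 2-step solvable Frobenius Lie algebra\<close>

context lie_algebra
begin

lemma ad_linear: "x \<in> carrier G \<Longrightarrow> linear_map K G G (lie_bracket G x)"
  by (rule linear_mapI)
    (simp_all add: vectorspace_axioms bracket_closed bracket_add_right bracket_smult_right)

lemma bracket_zero_right: "x \<in> carrier G \<Longrightarrow> lie_bracket G x \<zero>\<^bsub>G\<^esub> = \<zero>\<^bsub>G\<^esub>"
  by (rule linear_map.T0_is_0[OF ad_linear])

lemma bracket_neg_right: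
  "\<lbrakk>x \<in> carrier G; y \<in> carrier G\<rbrakk> \<Longrightarrow> lie_bracket G x (\<ominus>\<^bsub>G\<^esub> y) = \<ominus>\<^bsub>G\<^esub> lie_bracket G x y"
  by (rule linear_map.T_neg[OF ad_linear])

lemma bracket_antisym:
  assumes "x \<in> carrier G" "y \<in> carrier G"
  shows "lie_bracket G y x = \<ominus>\<^bsub>G\<^esub> lie_bracket G x y"
proof -
  have "\<zero>\<^bsub>G\<^esub> = lie_bracket G (x \<oplus>\<^bsub>G\<^esub> y) (x \<oplus>\<^bsub>G\<^esub> y)"
    using assms by (simp add: bracket_self)
  also have "\<dots> = lie_bracket G x (x \<oplus>\<^bsub>G\<^esub> y) \<oplus>\<^bsub>G\<^esub> lie_bracket G y (x \<oplus>\<^bsub>G\<^esub> y)"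
    using assms by (simp add: bracket_add_left)
  also have "\<dots> = lie_bracket G y x \<oplus>\<^bsub>G\<^esub> lie_bracket G x y"
    using assms by (simp add: bracket_add_right bracket_closed bracket_self M.a_comm)
  finally have "lie_bracket G y x \<oplus>\<^bsub>G\<^esub> lie_bracket G x y = \<zero>\<^bsub>G\<^esub>" ..
  then show ?thesis
    using assms by (simp add: M.minus_equality bracket_closed)
qed

text \<open>This is the Jacobi identity rearranged by antisymmetry: bracketing with x is a
  derivation.\<close>

lemma bracket_derivation:
  assumes "x \<in> carrier G" "y \<in> carrier G" "z \<in> carrier G"
  shows "lie_bracket G x (lie_bracket G y z)
    = lie_bracket G (lie_bracket G x y) z \<oplus>\<^bsub>G\<^esub> lie_bracket G y (lie_bracket G x z)"
proof -
  let ?a = "lie_bracket G x (lie_bracket G y z)" and ?b = "lie_bracket G y (lie_bracket G x z)"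
    and ?c = "lie_bracket G (lie_bracket G x y) z"
  have mem: "?a \<in> carrier G" "?b \<in> carrier G" "?c \<in> carrier G"
    using assms by (simp_all add: bracket_closed)
  have "lie_bracket G y (lie_bracket G z x) = \<ominus>\<^bsub>G\<^esub> ?b"
    "lie_bracket G z (lie_bracket G x y) = \<ominus>\<^bsub>G\<^esub> ?c"
    using assms bracket_antisym[of x z] bracket_antisym[of "lie_bracket G x y" z]
    by (simp_all add: bracket_neg_right bracket_closed)
  then have "?a \<oplus>\<^bsub>G\<^esub> \<ominus>\<^bsub>G\<^esub> ?b \<oplus>\<^bsub>G\<^esub> \<ominus>\<^bsub>G\<^esub> ?c = \<zero>\<^bsub>G\<^esub>"
    using jacobi[OF assms] by simp
  then have "?a \<oplus>\<^bsub>G\<^esub> \<ominus>\<^bsub>G\<^esub> (?c \<oplus>\<^bsub>G\<^esub> ?b) = \<zero>\<^bsub>G\<^esub>"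
    using mem by (simp add: M.minus_add M.a_ac)
  then show ?thesis
    using mem by (metis M.a_closed M.a_inv_closed M.minus_equality M.minus_minus)
qed

lemma derived_ideal_subspace: "subspace K derived_ideal G"
  unfolding derived_ideal_def by (rule span_is_subspace) (auto simp: bracket_closed)

lemma derived_ideal_subset: "derived_ideal \<subseteq> carrier G"
  using derived_ideal_subspace by (rule subspace_subset)

lemma bracket_in_derived_ideal:
  "\<lbrakk>x \<in> carrier G; y \<in> carrier G\<rbrakk> \<Longrightarrow> lie_bracket G x y \<in> derived_ideal"
  unfolding derived_ideal_def
  by (rule subsetD[OF in_own_span]) (auto simp: bracket_closed)

end

locale two_step_frobenius = fin_dim_lie_algebra class_ring G
  for G :: "('k :: field, 'g) lie_structure" +
  fixes \<alpha> :: "'g \<Rightarrow> 'k"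
  assumes two_step_solvable: two_step_solvable
    and frobenius_functional: "frobenius_functional \<alpha>"
begin

lemma derived_ideal_abelian:
  "\<lbrakk>x \<in> derived_ideal; y \<in> derived_ideal\<rbrakk> \<Longrightarrow> lie_bracket G x y = \<zero>\<^bsub>G\<^esub>"
  using two_step_solvable by (simp add: two_step_solvable_def)

lemma functional_add: "\<lbrakk>x \<in> carrier G; y \<in> carrier G\<rbrakk> \<Longrightarrow> \<alpha> (x \<oplus>\<^bsub>G\<^esub> y) = \<alpha> x + \<alpha> y"
  and functional_smult: "x \<in> carrier G \<Longrightarrow> \<alpha> (c \<odot>\<^bsub>G\<^esub> x) = c * \<alpha> x"
  using frobenius_functional by (simp_all add: frobenius_functional_def dual_space_class_ring)

lemma functional_zero: "\<alpha> \<zero>\<^bsub>G\<^esub> = 0"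
  by (metis M.r_zero M.zero_closed add_cancel_left_right functional_add)

lemma nondegenerate:
  assumes "u \<in> carrier G" "\<And>v. v \<in> carrier G \<Longrightarrow> \<alpha> (lie_bracket G u v) = 0"
  shows "u = \<zero>\<^bsub>G\<^esub>"
  using assms frobenius_functional
  by (simp add: frobenius_functional_def coboundary_def class_ring_simps)

lemma pairing_subspaces:
  assumes "subspace class_ring U G" "subspace class_ring V G"
  shows "pairing (vs U) (vs V) (\<lambda>u v. \<alpha> (lie_bracket G u v))"
proof -
  interpret U: vectorspace class_ring "vs U"
    using assms(1) by (rule subspace_is_vs)
  interpret V: vectorspace class_ring "vs V"
    using assms(2) by (rule subspace_is_vs)
  show ?thesis
    using subspace_subset[OF assms(1)] subspace_subset[OF assms(2)]
    by unfold_locales (auto simp: subset_iff bracket_add_left bracket_add_right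
      bracket_smult_left bracket_smult_right bracket_closed functional_add functional_smult)
qed

text \<open>The form \<alpha> [u, v] pairs G with itself without degeneracy, and the dimensions
  trivially agree, so every functional is represented, in particular \<alpha> itself.\<close>

lemma ex_principal_element:
  "\<exists>u \<in> carrier G. \<forall>v \<in> carrier G. \<alpha> (lie_bracket G u v) = \<alpha> v"
proof -
  interpret P: pairing G G "\<lambda>u v. \<alpha> (lie_bracket G u v)"
    by unfold_locales (simp_all add: bracket_add_left bracket_add_right
      bracket_smult_left bracket_smult_right bracket_closed functional_add functional_smult)
  have "P.left_nondegenerate"
    using nondegenerate by (auto simp: P.left_nondegenerate_def)
  then have "P.represents_dual"
    using P.left_nondegenerate_dim_le(2) finite_dimensional by simp
  then show ?thesis
    using frobenius_functional by (auto simp: P.represents_dual_def frobenius_functional_def)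
qed

text \<open>The principal element of the Frobenius Lie algebra with respect to \<alpha>. It is
  unique by \<open>nondegenerate\<close>, so the choice is immaterial.\<close>

definition principal :: 'g where
  "principal = (SOME u. u \<in> carrier G \<and> (\<forall>v \<in> carrier G. \<alpha> (lie_bracket G u v) = \<alpha> v))"

lemma principal_closed: "principal \<in> carrier G"
  and functional_principal: "v \<in> carrier G \<Longrightarrow> \<alpha> (lie_bracket G principal v) = \<alpha> v"
proof -
  have "principal \<in> carrier G \<and> (\<forall>v \<in> carrier G. \<alpha> (lie_bracket G principal v) = \<alpha> v)"
    unfolding principal_def by (rule someI_ex, rule ex_principal_element[unfolded Bex_def])
  then show "principal \<in> carrier G"
    "v \<in> carrier G \<Longrightarrow> \<alpha> (lie_bracket G principal v) = \<alpha> v"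
    by auto
qed

text \<open>The name anticipates \<open>proj_in_derived_ideal\<close> and
  \<open>proj_derived_ideal\<close>: bracketing with the principal element maps into the derived
  ideal and fixes it pointwise.\<close>

abbreviation proj :: "'g \<Rightarrow> 'g" where
  "proj \<equiv> lie_bracket G principal"

lemma proj_closed: "x \<in> carrier G \<Longrightarrow> proj x \<in> carrier G"
  and proj_in_derived_ideal: "x \<in> carrier G \<Longrightarrow> proj x \<in> derived_ideal"
  using principal_closed by (simp_all add: bracket_closed bracket_in_derived_ideal)

lemma proj_derived_ideal:
  assumes a: "a \<in> derived_ideal"
  shows "proj a = a"
proof -
  have aG: "a \<in> carrier G"
    using a derived_ideal_subset by auto
  have "proj a \<oplus>\<^bsub>G\<^esub> \<ominus>\<^bsub>G\<^esub> a = \<zero>\<^bsub>G\<^esub>"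
  proof (rule nondegenerate)
    fix v assume v: "v \<in> carrier G"
    \<comment> \<open>Both arguments lie in the derived ideal, so one term of the derivation rule
      for \<open>proj\<close> disappears.\<close>
    have "lie_bracket G a (proj v) = \<zero>\<^bsub>G\<^esub>"
      using a v by (intro derived_ideal_abelian proj_in_derived_ideal)
    then have "proj (lie_bracket G a v) = lie_bracket G (proj a) v"
      using bracket_derivation[OF principal_closed aG v] v aG
      by (simp add: proj_closed bracket_closed)
    then have "\<alpha> (lie_bracket G (proj a) v) = \<alpha> (lie_bracket G a v)"
      using functional_principal[of "lie_bracket G a v"] v aG by (simp add: bracket_closed)
    moreover have "lie_bracket G (\<ominus>\<^bsub>G\<^esub> a) v = (- 1) \<odot>\<^bsub>G\<^esub> lie_bracket G a v"
      using bracket_smult_left[OF _ aG v, of "- 1"] smult_minus_1[OF aG]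
      by (simp add: class_ring_simps)
    ultimately show "\<alpha> (lie_bracket G (proj a \<oplus>\<^bsub>G\<^esub> \<ominus>\<^bsub>G\<^esub> a) v) = 0"
      using v aG
      by (simp add: bracket_add_left proj_closed bracket_closed functional_add functional_smult)
  qed (use aG proj_closed in simp)
  then show ?thesis
    using aG proj_closed by (metis M.a_inv_closed M.minus_equality M.minus_minus)
qed

abbreviation complement :: "'g set" where
  "complement \<equiv> {x \<in> carrier G. proj x = \<zero>\<^bsub>G\<^esub>}"

lemma complement_subspace: "subspace class_ring complement G"
  using linear_map.kerT_is_subspace[OF ad_linear[OF principal_closed]]
    linear_map.axioms(3)[OF ad_linear[OF principal_closed]]
  by (simp add: mod_hom.ker_def)

text \<open>The bracket [b, c] lies in the derived ideal and is fixed by \<open>proj\<close>,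
  whereas the derivation rule expands its projection into two terms that vanish because
  \<open>proj\<close> kills b and c.\<close>

lemma complement_abelian:
  assumes "b \<in> complement" "c \<in> complement"
  shows "lie_bracket G b c = \<zero>\<^bsub>G\<^esub>"
proof -
  have "lie_bracket G b c = proj (lie_bracket G b c)"
    using assms by (intro proj_derived_ideal[symmetric] bracket_in_derived_ideal) auto
  also have "\<dots> = lie_bracket G \<zero>\<^bsub>G\<^esub> c \<oplus>\<^bsub>G\<^esub> lie_bracket G b \<zero>\<^bsub>G\<^esub>"
    using assms by (simp add: bracket_derivation principal_closed)
  also have "\<dots> = \<zero>\<^bsub>G\<^esub>"
    using assms bracket_antisym[of c "\<zero>\<^bsub>G\<^esub>"] by (simp add: bracket_zero_right)
  finally show ?thesis .
qed

lemma minus_proj_in_complement: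
  assumes "x \<in> carrier G"
  shows "x \<ominus>\<^bsub>G\<^esub> proj x \<in> complement"
  using assms proj_closed proj_derived_ideal[OF proj_in_derived_ideal]
    linear_map.T_minus[OF ad_linear[OF principal_closed], of x "proj x"]
  by (simp add: M.minus_eq M.r_neg)

lemma decompose: "x \<in> carrier G \<Longrightarrow> x = (x \<ominus>\<^bsub>G\<^esub> proj x) \<oplus>\<^bsub>G\<^esub> proj x"
  using proj_closed by (simp add: M.minus_eq M.a_assoc M.l_neg)

text \<open>Splitting v along the decomposition, its component in the complement commutes with b, so
  \<alpha> [b, v] depends only on the component in the derived ideal. Nondegeneracy on G thus passes
  to the pairing of the complement with the derived ideal.\<close>

lemma complement_faithful:
  assumes b: "b \<in> complement" "\<And>a. a \<in> derived_ideal \<Longrightarrow> \<alpha> (lie_bracket G b a) = 0"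
  shows "b = \<zero>\<^bsub>G\<^esub>"
proof (rule nondegenerate)
  fix v assume v: "v \<in> carrier G"
  have "lie_bracket G b v = lie_bracket G b (v \<ominus>\<^bsub>G\<^esub> proj v) \<oplus>\<^bsub>G\<^esub> lie_bracket G b (proj v)"
    using v b(1) minus_proj_in_complement[OF v] proj_closed[OF v]
    by (subst decompose[OF v]) (simp add: bracket_add_right)
  also have "\<dots> = lie_bracket G b (proj v)"
    using v b(1) proj_closed[OF v] complement_abelian[OF b(1) minus_proj_in_complement[OF v]]
      by (simp add: bracket_closed)
  finally show "\<alpha> (lie_bracket G b v) = 0"
    using b(2) proj_in_derived_ideal[OF v] by simp
qed (use b in simp)

text \<open>The mirror image of \<open>complement_faithful\<close>: now the component of v in the
  derived ideal commutes with a.\<close>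

lemma derived_ideal_faithful:
  assumes a: "a \<in> derived_ideal" "\<And>b. b \<in> complement \<Longrightarrow> \<alpha> (lie_bracket G a b) = 0"
  shows "a = \<zero>\<^bsub>G\<^esub>"
proof (rule nondegenerate)
  show aG: "a \<in> carrier G"
    using a(1) derived_ideal_subset by auto
  fix v assume v: "v \<in> carrier G"
  have "lie_bracket G a v = lie_bracket G a (v \<ominus>\<^bsub>G\<^esub> proj v) \<oplus>\<^bsub>G\<^esub> lie_bracket G a (proj v)"
    using v aG minus_proj_in_complement[OF v] proj_closed[OF v]
    by (subst decompose[OF v]) (simp add: bracket_add_right)
  also have "\<dots> = lie_bracket G a (v \<ominus>\<^bsub>G\<^esub> proj v)"
    using v aG minus_proj_in_complement[OF v]
      derived_ideal_abelian[OF a(1) proj_in_derived_ideal[OF v]]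
    by (simp add: bracket_closed)
  finally show "\<alpha> (lie_bracket G a v) = 0"
    using a(2) minus_proj_in_complement[OF v] by simp
qed

lemma fin_dim_derived_ideal: "vectorspace.fin_dim class_ring (vs derived_ideal)"
  and fin_dim_complement: "vectorspace.fin_dim class_ring (vs complement)"
  using subspace_fin_dim[OF finite_dimensional] derived_ideal_subspace complement_subspace by auto

text \<open>The pairing is nondegenerate on both sides, which gives the two inequalities of
  dimensions. With equality, every functional on the derived ideal comes from the complement; this
  is the source of the open orbit.\<close>

lemma dim_complement: "vectorspace.dim class_ring (vs complement)
  = vectorspace.dim class_ring (vs derived_ideal)"
  and represents_dual_derived_ideal:
    "pairing.represents_dual (vs complement) (vs derived_ideal) (\<lambda>u v. \<alpha> (lie_bracket G u v))"
proof -
  interpret BA: pairing "vs complement" "vs derived_ideal" "\<lambda>u v. \<alpha> (lie_bracket G u v)"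
    using complement_subspace derived_ideal_subspace by (rule pairing_subspaces)
  interpret AB: pairing "vs derived_ideal" "vs complement" "\<lambda>u v. \<alpha> (lie_bracket G u v)"
    using derived_ideal_subspace complement_subspace by (rule pairing_subspaces)
  have BA: "BA.left_nondegenerate"
    using complement_faithful by (auto simp: BA.left_nondegenerate_def)
  have AB: "AB.left_nondegenerate"
    using derived_ideal_faithful by (auto simp: AB.left_nondegenerate_def)
  show "BA.U.dim = BA.V.dim"
    using BA.left_nondegenerate_dim_le(1)[OF fin_dim_complement fin_dim_derived_ideal BA]
      AB.left_nondegenerate_dim_le(1)[OF fin_dim_derived_ideal fin_dim_complement AB]
        by (rule antisym)
  then show "BA.represents_dual"
    using BA.left_nondegenerate_dim_le(2)[OF fin_dim_complement fin_dim_derived_ideal BA] by simp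
qed

end

section \<open>Matrices of the adjoint action on the derived ideal\<close>

lemma mat_eqI_mult_vec:
  fixes A B :: "'k :: field mat"
  assumes "A \<in> carrier_mat m n" "B \<in> carrier_mat m n"
    and "\<And>x. x \<in> carrier_vec n \<Longrightarrow> A *\<^sub>v x = B *\<^sub>v x"
  shows "A = B"
proof (rule eq_matI)
  fix i j assume ij: "i < dim_row B" "j < dim_col B"
  have "(A *\<^sub>v unit_vec n j) $ i = (B *\<^sub>v unit_vec n j) $ i"
    by (simp add: assms(3))
  then show "A $$ (i, j) = B $$ (i, j)"
    using ij assms(1,2) by simp
qed (use assms in auto)

context two_step_frobenius
begin

text \<open>By \<open>dim_complement\<close> the two summands of G have this same dimension, so it
  is half the dimension of G. It serves as the n of the matrix model.\<close>

abbreviation half_dim :: nat where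
  "half_dim \<equiv> vectorspace.dim class_ring (vs derived_ideal)"

definition of_coords :: "'k vec \<Rightarrow> 'g" where
  "of_coords = (SOME f. linear_map class_ring (module_vec TYPE('k) half_dim) (vs derived_ideal) f \<and>
     bij_betw f (carrier_vec half_dim) derived_ideal)"

definition coords :: "'g \<Rightarrow> 'k vec" where
  "coords = inv_into (carrier_vec half_dim) of_coords"

lemma of_coords_linear: "linear_map class_ring (module_vec TYPE('k) half_dim) (vs derived_ideal)
  of_coords"
  and of_coords_bij: "bij_betw of_coords (carrier_vec half_dim) derived_ideal"
proof -
  have "vectorspace class_ring (vs derived_ideal)"
    using derived_ideal_subspace by (rule subspace_is_vs)
  then have "\<exists>f. linear_map class_ring (module_vec TYPE('k) half_dim) (vs derived_ideal) f \<and>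
      bij_betw f (carrier_vec half_dim) derived_ideal"
    using vectorspace_coordinates[OF _ fin_dim_derived_ideal] by (metis carrier_vs_is_self)
  then have "linear_map class_ring (module_vec TYPE('k) half_dim) (vs derived_ideal) of_coords \<and>
      bij_betw of_coords (carrier_vec half_dim) derived_ideal"
    unfolding of_coords_def by (rule someI_ex)
  then show "linear_map class_ring (module_vec TYPE('k) half_dim) (vs derived_ideal) of_coords"
    "bij_betw of_coords (carrier_vec half_dim) derived_ideal"
    by auto
qed

lemma zero_in_derived_ideal: "\<zero>\<^bsub>G\<^esub> \<in> derived_ideal"
  using submodule.zero_closed[OF is_module[OF derived_ideal_subspace]] .

lemma of_coords_closed: "x \<in> carrier_vec half_dim \<Longrightarrow> of_coords x \<in> derived_ideal"
  and coords_closed: "a \<in> derived_ideal \<Longrightarrow> coords a \<in> carrier_vec half_dim"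
  and of_coords_coords: "a \<in> derived_ideal \<Longrightarrow> of_coords (coords a) = a"
  and coords_of_coords: "x \<in> carrier_vec half_dim \<Longrightarrow> coords (of_coords x) = x"
  using of_coords_bij by (auto simp: coords_def bij_betw_def inv_into_into f_inv_into_f
    inv_into_f_f)

lemma of_coords_add: "\<lbrakk>x \<in> carrier_vec half_dim; y \<in> carrier_vec half_dim\<rbrakk> \<Longrightarrow> of_coords (x + y)
  = of_coords x \<oplus>\<^bsub>G\<^esub> of_coords y"
  and of_coords_smult: "x \<in> carrier_vec half_dim \<Longrightarrow> of_coords (c \<cdot>\<^sub>v x) = c \<odot>\<^bsub>G\<^esub> of_coords x"
  using linear_map.T_add[OF of_coords_linear, of x y]
    linear_map.T_smult[OF of_coords_linear, of c x]
  by (simp_all add: module_vec_simps)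

lemma coords_add: "\<lbrakk>a \<in> derived_ideal; b \<in> derived_ideal\<rbrakk> \<Longrightarrow> coords (a \<oplus>\<^bsub>G\<^esub> b) = coords a + coords b"
  and coords_smult: "a \<in> derived_ideal \<Longrightarrow> coords (c \<odot>\<^bsub>G\<^esub> a) = c \<cdot>\<^sub>v coords a"
proof -
  have coords_linear: "linear_map class_ring (vs derived_ideal) (module_vec TYPE('k) half_dim)
    coords"
    using linear_map.inv_into_linear[OF of_coords_linear] of_coords_bij
      by (simp add: coords_def module_vec_simps)
  show "\<lbrakk>a \<in> derived_ideal; b \<in> derived_ideal\<rbrakk> \<Longrightarrow> coords (a \<oplus>\<^bsub>G\<^esub> b) = coords a + coords b"
    and "a \<in> derived_ideal \<Longrightarrow> coords (c \<odot>\<^bsub>G\<^esub> a) = c \<cdot>\<^sub>v coords a"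
    using linear_map.T_add[OF coords_linear, of a b] linear_map.T_smult[OF coords_linear, of c a]
    by (simp_all add: module_vec_simps)
qed

lemma coords_zero: "coords \<zero>\<^bsub>G\<^esub> = 0\<^sub>v half_dim"
  using coords_smult[of "\<zero>\<^bsub>G\<^esub>" 0] zero_smult_vec[OF coords_closed] zero_in_derived_ideal by simp

text \<open>Taken for all of G and not only for the complement, so that it is one linear map on G.
  It kills the derived ideal and so sees only the component in the complement.\<close>

definition ad_mat :: "'g \<Rightarrow> 'k mat" where
  "ad_mat g = mat half_dim half_dim (\<lambda>(i, j). coords (lie_bracket G g (of_coords (unit_vec
    half_dim j))) $ i)"

lemma ad_mat_closed: "ad_mat g \<in> carrier_mat half_dim half_dim"
  by (simp add: ad_mat_def)

lemma of_coords_closed_G: "x \<in> carrier_vec half_dim \<Longrightarrow> of_coords x \<in> carrier G"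
  using of_coords_closed derived_ideal_subset by auto

lemma ad_mat_mult_vec:
  assumes "g \<in> carrier G" "x \<in> carrier_vec half_dim"
  shows "ad_mat g *\<^sub>v x = coords (lie_bracket G g (of_coords x))"
  unfolding ad_mat_def using assms
  by (intro mat_of_linear[where L = "\<lambda>x. coords (lie_bracket G g (of_coords x))"])
    (simp_all add: coords_closed bracket_in_derived_ideal of_coords_closed_G of_coords_add
        of_coords_smult
      bracket_add_right bracket_smult_right coords_add coords_smult)

lemma ad_mat_linear: "linear_map class_ring G (module_mat TYPE('k) half_dim half_dim) ad_mat"
proof (rule linear_mapI)
  fix g h c assume gh: "g \<in> carrier G"
  show "ad_mat (c \<odot>\<^bsub>G\<^esub> g) = c \<odot>\<^bsub>module_mat TYPE('k) half_dim half_dim\<^esub> ad_mat g"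
    using gh by (intro mat_eqI_mult_vec[of _ half_dim half_dim])
      (simp_all add: ad_mat_closed module_mat_simps ad_mat_mult_vec
          mat_smult_mult_vec[of _ half_dim]
        bracket_smult_left of_coords_closed_G coords_smult bracket_in_derived_ideal)
  assume "h \<in> carrier G"
  then show "ad_mat (g \<oplus>\<^bsub>G\<^esub> h) = ad_mat g \<oplus>\<^bsub>module_mat TYPE('k) half_dim half_dim\<^esub> ad_mat h"
    using gh by (intro mat_eqI_mult_vec[of _ half_dim half_dim])
      (simp_all add: ad_mat_closed module_mat_simps ad_mat_mult_vec
          add_mult_distrib_mat_vec[of _ half_dim half_dim]
        bracket_add_left of_coords_closed_G coords_add bracket_in_derived_ideal)
qed (simp_all add: vectorspace_axioms matrix_vs ad_mat_closed module_mat_simps)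

lemma ad_mat_derived_ideal:
  assumes "a \<in> derived_ideal"
  shows "ad_mat a = 0\<^sub>m half_dim half_dim"
proof (rule mat_eqI_mult_vec[of _ half_dim half_dim])
  have "a \<in> carrier G"
    using assms derived_ideal_subset by auto
  then show "ad_mat a *\<^sub>v x = 0\<^sub>m half_dim half_dim *\<^sub>v x" if "x \<in> carrier_vec half_dim" for x
    using that assms
    by (simp add: ad_mat_mult_vec derived_ideal_abelian of_coords_closed coords_zero
        zero_mat_mult_vec)
qed (simp_all add: ad_mat_closed)

text \<open>The commutator of the actions of g and h is the action of [g, h], an element of the
  Abelian derived ideal, and so it is zero there.\<close>

lemma ad_mat_commute:
  assumes "g \<in> carrier G" "h \<in> carrier G"
  shows "ad_mat g * ad_mat h = ad_mat h * ad_mat g"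
proof (rule mat_eqI_mult_vec[of _ half_dim half_dim])
  have prod: "(ad_mat g * ad_mat h) *\<^sub>v x = coords (lie_bracket G g (lie_bracket G h (of_coords
    x)))"
    if "g \<in> carrier G" "h \<in> carrier G" "x \<in> carrier_vec half_dim" for g h and x :: "'k vec"
    using that assoc_mult_mat_vec[OF ad_mat_closed ad_mat_closed that(3)]
    by (simp add: ad_mat_mult_vec coords_closed of_coords_coords bracket_in_derived_ideal
        of_coords_closed_G)
  fix x :: "'k vec" assume x: "x \<in> carrier_vec half_dim"
  have "lie_bracket G (lie_bracket G g h) (of_coords x) = \<zero>\<^bsub>G\<^esub>"
    using assms x by (intro derived_ideal_abelian bracket_in_derived_ideal of_coords_closed)
  then have "lie_bracket G g (lie_bracket G h (of_coords x))
    = lie_bracket G h (lie_bracket G g (of_coords x))"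
    using bracket_derivation[of g h "of_coords x"] assms x
      by (simp add: of_coords_closed_G bracket_closed)
  then show "(ad_mat g * ad_mat h) *\<^sub>v x = (ad_mat h * ad_mat g) *\<^sub>v x"
    using assms x by (simp add: prod)
qed (rule mult_carrier_mat[OF ad_mat_closed ad_mat_closed])+

text \<open>A zero matrix means that b commutes with the derived ideal, so its pairing with the
  derived ideal vanishes and \<open>complement_faithful\<close> applies.\<close>

lemma ad_mat_complement_zero_imp_zero:
  assumes b: "b \<in> complement" "ad_mat b = 0\<^sub>m half_dim half_dim"
  shows "b = \<zero>\<^bsub>G\<^esub>"
proof (rule complement_faithful[OF b(1)])
  fix a assume a: "a \<in> derived_ideal"
  then have aG: "a \<in> carrier G"
    using derived_ideal_subset by auto
  have "coords (lie_bracket G b a) = ad_mat b *\<^sub>v coords a"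
    using a b(1) by (simp add: ad_mat_mult_vec coords_closed of_coords_coords)
  also have "\<dots> = coords \<zero>\<^bsub>G\<^esub>"
    using a b(2) by (simp add: zero_mat_mult_vec coords_closed coords_zero)
  finally have "of_coords (coords (lie_bracket G b a)) = of_coords (coords \<zero>\<^bsub>G\<^esub>)"
    by simp
  then have "lie_bracket G b a = \<zero>\<^bsub>G\<^esub>"
    using a aG b(1) zero_in_derived_ideal
    by (simp add: of_coords_coords bracket_in_derived_ideal)
  then show "\<alpha> (lie_bracket G b a) = 0"
    by (simp add: functional_zero)
qed

lemma ad_mat_minus_proj:
  assumes "g \<in> carrier G"
  shows "ad_mat (g \<ominus>\<^bsub>G\<^esub> proj g) = ad_mat g"
proof -
  have "ad_mat g = ad_mat (g \<ominus>\<^bsub>G\<^esub> proj g) + ad_mat (proj g)"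
    using linear_map.T_add[OF ad_mat_linear, of "g \<ominus>\<^bsub>G\<^esub> proj g" "proj g"] decompose[OF assms] assms
      proj_closed[OF assms] by (simp add: module_mat_simps)
  then show ?thesis
    using ad_mat_derived_ideal[OF proj_in_derived_ideal[OF assms]]
      right_add_zero_mat[OF ad_mat_closed] by simp
qed

lemma ad_mat_image_complement: "ad_mat ` complement = ad_mat ` carrier G"
  using ad_mat_minus_proj minus_proj_in_complement by (auto simp: image_iff) metis

lemma ad_mat_linear_complement: "linear_map class_ring (vs complement) (module_mat TYPE('k)
  half_dim half_dim) ad_mat"
  using linear_map.T_add[OF ad_mat_linear] linear_map.T_smult[OF ad_mat_linear]
  by (intro linear_mapI)
    (simp_all add: subspace_is_vs[OF complement_subspace] matrix_vs ad_mat_closed module_mat_simps)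

lemma ad_mat_inj_on_complement: "inj_on ad_mat complement"
proof -
  interpret N: linear_map class_ring "vs complement" "module_mat TYPE('k) half_dim half_dim" ad_mat
    by (rule ad_mat_linear_complement)
  have "N.kerT = {b \<in> complement. ad_mat b = 0\<^sub>m half_dim half_dim}"
    by (simp only: N.ker_def module_mat_simps carrier_vs_is_self)
  moreover have "\<zero>\<^bsub>G\<^esub> \<in> {b \<in> complement. ad_mat b = 0\<^sub>m half_dim half_dim}"
    using ad_mat_derived_ideal[OF zero_in_derived_ideal]
    by (simp add: bracket_zero_right principal_closed)
  ultimately have "N.kerT = {\<zero>\<^bsub>G\<^esub>}"
    using ad_mat_complement_zero_imp_zero by blast
  then have "inj_on ad_mat (carrier (vs complement))"
    by (intro N.Ke0_imp_inj) simp
  then show ?thesis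
    by (simp only: carrier_vs_is_self)
qed

text \<open>The functional is the restriction of \<alpha> to the derived ideal, written in
  coordinates. Its orbit consists of the functionals - \<alpha> [b, _] with b in the complement, and
  \<open>represents_dual_derived_ideal\<close> says that these are all.\<close>

lemma ad_mat_image_has_open_orbit: "has_open_orbit half_dim (ad_mat ` complement)"
proof -
  let ?\<alpha> = "\<lambda>x\<in>carrier_vec half_dim. \<alpha> (of_coords x)"
  have \<alpha>: "?\<alpha> \<in> dual_space class_ring (module_vec TYPE('k) half_dim)"
    by (auto simp: dual_space_class_ring module_vec_simps of_coords_add of_coords_smult
        functional_add
        functional_smult of_coords_closed_G)
  have act: "dual_action half_dim (ad_mat b) ?\<alpha> = (\<lambda>x\<in>carrier_vec half_dim. - \<alpha> (lie_bracket G b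
    (of_coords x)))"
    if "b \<in> complement" for b
    unfolding dual_action_def using that
    by (intro restrict_ext)
      (simp add: ad_mat_mult_vec coords_closed of_coords_coords bracket_in_derived_ideal
          of_coords_closed_G)
  have "{dual_action half_dim a ?\<alpha> | a. a \<in> ad_mat ` complement}
    = dual_space class_ring (module_vec TYPE('k) half_dim)"
  proof (intro equalityI subsetI)
    fix f assume "f \<in> {dual_action half_dim a ?\<alpha> | a. a \<in> ad_mat ` complement}"
    then obtain b where b: "b \<in> complement"
      and f: "f = (\<lambda>x\<in>carrier_vec half_dim. - \<alpha> (lie_bracket G b (of_coords x)))"
      using act by blast
    show "f \<in> dual_space class_ring (module_vec TYPE('k) half_dim)"
      unfolding f using b
      by (auto simp: dual_space_class_ring module_vec_simps of_coords_add of_coords_smult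
          functional_add
          functional_smult of_coords_closed_G bracket_add_right bracket_smult_right bracket_closed)
  next
    fix f assume f: "f \<in> dual_space class_ring (module_vec TYPE('k) half_dim)"
    interpret P: pairing "vs complement" "vs derived_ideal" "\<lambda>u v. \<alpha> (lie_bracket G u v)"
      using complement_subspace derived_ideal_subspace by (rule pairing_subspaces)
    \<comment> \<open>The functional f is moved back to the derived ideal and negated, to match the
      sign in \<open>dual_action\<close>.\<close>
    have "(\<lambda>a\<in>derived_ideal. - f (coords a)) \<in> dual_space class_ring (vs derived_ideal)"
      using f submodule.m_closed[OF is_module[OF derived_ideal_subspace]]
        submodule.smult_closed[OF is_module[OF derived_ideal_subspace]]
      by (auto simp: dual_space_class_ring module_vec_simps coords_add coords_smult coords_closed)
    with represents_dual_derived_ideal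
    have "\<exists>b\<in>complement. \<forall>a\<in>derived_ideal. \<alpha> (lie_bracket G b a)
      = (\<lambda>a\<in>derived_ideal. - f (coords a)) a"
      unfolding P.represents_dual_def carrier_vs_is_self by (rule bspec)
    then obtain b where "b \<in> complement"
      "\<forall>a\<in>derived_ideal. \<alpha> (lie_bracket G b a) = (\<lambda>a\<in>derived_ideal. - f (coords a)) a"
      by (rule bexE)
    then have b: "b \<in> complement" "\<And>a. a \<in> derived_ideal \<Longrightarrow> \<alpha> (lie_bracket G b a) = - f (coords a)"
      by simp_all
    have "f = dual_action half_dim (ad_mat b) ?\<alpha>"
      unfolding act[OF b(1)] using f b(2)
      by (intro extensionalityI[of _ "carrier_vec half_dim"])
        (auto simp: dual_space_class_ring module_vec_simps of_coords_closed coords_of_coords)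
    then show "f \<in> {dual_action half_dim a ?\<alpha> | a. a \<in> ad_mat ` complement}"
      using b(1) by blast
  qed
  then show ?thesis
    using \<alpha> unfolding has_open_orbit_def by blast
qed

text \<open>The generators are the matrices of a basis of the complement. As \<open>ad_mat\<close>
  is injective there, they are independent and as many as the dimension of the complement, which is
  \<open>half_dim\<close>.\<close>

lemma commuting_generators:
  obtains A where "commuting_open_orbit_generators half_dim A"
    "mat_span half_dim A = ad_mat ` complement"
proof -
  interpret N: linear_map class_ring "vs complement" "module_mat TYPE('k) half_dim half_dim" ad_mat
    by (rule ad_mat_linear_complement)
  obtain \<beta> where \<beta>: "finite \<beta>" "N.V.basis \<beta>"
    using N.V.finite_basis_exists[OF fin_dim_complement] by auto
  then have sub: "\<beta> \<subseteq> complement" and li: "N.V.module.lin_indpt \<beta>"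
    and sp: "N.V.module.span \<beta> = complement"
    unfolding N.V.basis_def by auto
  have span: "mat_span half_dim (ad_mat ` \<beta>) = ad_mat ` complement"
    using N.image_span[of \<beta>] sub sp by (simp add: mat_span_def)
  have "card (ad_mat ` \<beta>) = half_dim"
    using card_image[OF inj_on_subset[OF ad_mat_inj_on_complement sub]] N.V.dim_basis[OF \<beta>]
      dim_complement by simp
  moreover have "N.W.module.lin_indpt (ad_mat ` \<beta>)"
    using N.inj_lin_indpt[OF _ \<beta>(1) _ li] ad_mat_inj_on_complement sub by simp
  moreover have "a * b = b * a" if "a \<in> ad_mat ` \<beta>" "b \<in> ad_mat ` \<beta>" for a b
    using that sub ad_mat_commute by auto
  ultimately have "commuting_open_orbit_generators half_dim (ad_mat ` \<beta>)"
    using \<beta>(1) ad_mat_closed ad_mat_image_has_open_orbit span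
    by (auto simp: commuting_open_orbit_generators_def)
  then show thesis
    using span by (rule that)
qed

text \<open>The isomorphism records the two components of g: \<open>ad_mat g\<close> determines the
  one in the complement, and \<open>proj g\<close> is the one in the derived ideal.\<close>

lemma semidirect_isomorphic: "lie_isomorphic class_ring G (semidirect half_dim (ad_mat `
  complement))"
proof -
  let ?S = "semidirect half_dim (ad_mat ` complement)" and ?\<phi> = "\<lambda>g. (ad_mat g, coords (proj g))"
  interpret MB: linear_map class_ring "vs complement" "module_mat TYPE('k) half_dim half_dim" ad_mat
    by (rule ad_mat_linear_complement)
  have "MB.imT = ad_mat ` complement"
    by (simp add: MB.im_def)
  then have S_vs: "vectorspace class_ring ?S"
    using MB.imT_is_subspace by (intro semidirect_vectorspace) simp
  have ad_mat_in: "ad_mat g \<in> ad_mat ` complement" if "g \<in> carrier G" for g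
    using that ad_mat_image_complement by auto
  have proj_add: "proj (x \<oplus>\<^bsub>G\<^esub> y) = proj x \<oplus>\<^bsub>G\<^esub> proj y" if "x \<in> carrier G" "y \<in> carrier G" for x y
    using that by (simp add: bracket_add_right principal_closed)
  have proj_smult: "proj (c \<odot>\<^bsub>G\<^esub> x) = c \<odot>\<^bsub>G\<^esub> proj x" if "x \<in> carrier G" for x c
    using that by (simp add: bracket_smult_right principal_closed)
  have "linear_map class_ring G ?S ?\<phi>"
    using linear_map.T_add[OF ad_mat_linear] linear_map.T_smult[OF ad_mat_linear]
    by (intro linear_mapI)
      (simp_all add: vectorspace_axioms S_vs semidirect_simps ad_mat_in coords_closed
          proj_in_derived_ideal
        proj_add proj_smult coords_add coords_smult module_mat_simps)
  then interpret \<phi>: linear_map class_ring G ?S ?\<phi> .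
  have "inj_on ?\<phi> (carrier G)"
  proof (rule \<phi>.Ke0_imp_inj)
    \<comment> \<open>A vanishing second component puts g in the complement, where the first
      component is faithful.\<close>
    have "g = \<zero>\<^bsub>G\<^esub>" if g: "g \<in> carrier G" and Mg: "ad_mat g = 0\<^sub>m half_dim half_dim"
      and dg: "coords (proj g) = 0\<^sub>v half_dim" for g
    proof -
      have "proj g = of_coords (coords (proj g))" "\<zero>\<^bsub>G\<^esub> = of_coords (coords \<zero>\<^bsub>G\<^esub>)"
        using g zero_in_derived_ideal
        by (simp_all add: of_coords_coords proj_in_derived_ideal)
      then have "proj g = \<zero>\<^bsub>G\<^esub>"
        using dg coords_zero by simp
      then show ?thesis
        using g Mg by (intro ad_mat_complement_zero_imp_zero) auto
    qed
    then show "carrier (vs \<phi>.kerT) = {\<zero>\<^bsub>G\<^esub>}"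
      using ad_mat_derived_ideal[OF zero_in_derived_ideal]
      by (auto simp: \<phi>.ker_def semidirect_simps bracket_zero_right principal_closed coords_zero)
  qed
  moreover have "?\<phi> ` carrier G = carrier ?S"
  proof
    show "?\<phi> ` carrier G \<subseteq> carrier ?S"
      using \<phi>.T_im by auto
    show "carrier ?S \<subseteq> ?\<phi> ` carrier G"
    proof
      fix v assume "v \<in> carrier ?S"
      then obtain b x where v: "v = (ad_mat b, x)" "b \<in> complement" "x \<in> carrier_vec half_dim"
        by (auto simp: semidirect_simps)
      \<comment> \<open>The preimage adds the two components: \<open>proj\<close> kills b and fixes
        \<open>of_coords x\<close>, and \<open>ad_mat\<close> kills
        \<open>of_coords x\<close>.\<close>
      let ?g = "b \<oplus>\<^bsub>G\<^esub> of_coords x"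
      have "proj ?g = of_coords x"
        using v of_coords_closed_G[OF v(3)] proj_derived_ideal[OF of_coords_closed[OF v(3)]]
          by (simp add: proj_add)
      moreover have "ad_mat ?g = ad_mat b"
        using v of_coords_closed_G[OF v(3)] ad_mat_derived_ideal[OF of_coords_closed[OF v(3)]]
          linear_map.T_add[OF ad_mat_linear, of b "of_coords x"]
          right_add_zero_mat[OF ad_mat_closed]
        by (simp add: module_mat_simps)
      moreover have "?g \<in> carrier G"
        using v of_coords_closed_G by simp
      ultimately show "v \<in> ?\<phi> ` carrier G"
        using v coords_of_coords by (intro image_eqI[of _ _ ?g]) simp_all
    qed
  qed
  moreover have "?\<phi> (lie_bracket G g h) = lie_bracket ?S (?\<phi> g) (?\<phi> h)"
    if gh: "g \<in> carrier G" "h \<in> carrier G" for g h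
  proof -
    have der: "lie_bracket G g h \<in> derived_ideal"
      using gh by (rule bracket_in_derived_ideal)
    have act: "ad_mat g *\<^sub>v coords (proj h) = coords (lie_bracket G g (proj h))"
      if "g \<in> carrier G" "h \<in> carrier G" for g h
      using that by (simp add: ad_mat_mult_vec coords_closed of_coords_coords proj_in_derived_ideal)
    \<comment> \<open>Expanding the fixed element [g, h] by the derivation rule gives [proj g, h] +
      [g, proj h], whose coordinates form the second component of the bracket in the semidirect
      product. The first component is zero because [g, h] lies in the derived ideal.\<close>
    have "lie_bracket G g h = proj (lie_bracket G g h)"
      using proj_derived_ideal[OF der] by simp
    also have "\<dots> = lie_bracket G (proj g) h \<oplus>\<^bsub>G\<^esub> lie_bracket G g (proj h)"
      using gh principal_closed by (intro bracket_derivation)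
    also have "\<dots> = (- 1) \<odot>\<^bsub>G\<^esub> lie_bracket G h (proj g) \<oplus>\<^bsub>G\<^esub> lie_bracket G g (proj h)"
      using gh bracket_antisym[of h "proj g"] smult_minus_1[of "lie_bracket G h (proj g)"]
      by (simp add: proj_closed bracket_closed class_ring_simps)
    finally have "coords (lie_bracket G g h) = (- 1) \<cdot>\<^sub>v (ad_mat h *\<^sub>v coords (proj g)) + ad_mat
      g *\<^sub>v coords (proj h)"
      using gh submodule.smult_closed[OF is_module[OF derived_ideal_subspace]]
      by (simp add: act coords_add coords_smult bracket_in_derived_ideal proj_closed)
    also have "\<dots> = ad_mat g *\<^sub>v coords (proj h) - ad_mat h *\<^sub>v coords (proj g)"
      using ad_mat_closed[of g] ad_mat_closed[of h] by (intro eq_vecI) auto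
    finally show ?thesis
      using proj_derived_ideal[OF der] ad_mat_derived_ideal[OF der] by (simp add: semidirect_simps)
  qed
  ultimately show ?thesis
    unfolding lie_isomorphic_def bij_betw_def using \<phi>.linear_map_axioms by blast
qed

end

theorem theorem3p1:
  shows "(\<forall>(n :: nat) (A :: 'k :: field_char_0 mat set).
            commuting_open_orbit_generators n A \<longrightarrow>
            two_step_solvable_frobenius_lie_algebra class_ring (semidirect n (mat_span n A)))
       \<and> (\<forall>G :: ('k, 'g) lie_structure.
            two_step_solvable_frobenius_lie_algebra class_ring G \<longrightarrow>
            (\<exists>(n :: nat) (A :: 'k mat set).
               commuting_open_orbit_generators n A \<and>
               lie_isomorphic class_ring G (semidirect n (mat_span n A))))"
proof (intro conjI allI impI)
  show "two_step_solvable_frobenius_lie_algebra class_ring (semidirect n (mat_span n A))"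
    if "commuting_open_orbit_generators n A" for n and A :: "'k mat set"
    using that by (rule semidirect_two_step_solvable_frobenius)
next
  fix G :: "('k, 'g) lie_structure"
  assume G: "two_step_solvable_frobenius_lie_algebra class_ring G"
  then interpret fin_dim_lie_algebra class_ring G
    by (simp add: two_step_solvable_frobenius_lie_algebra_def)
  obtain \<alpha> where "frobenius_functional \<alpha>"
    using G by (auto simp: two_step_solvable_frobenius_lie_algebra_def frobenius_def)
  moreover have two_step_solvable
    using G by (simp add: two_step_solvable_frobenius_lie_algebra_def)
  ultimately interpret two_step_frobenius G \<alpha>
    by unfold_locales
  obtain A where "commuting_open_orbit_generators half_dim A"
    "mat_span half_dim A = ad_mat ` complement"
    by (rule commuting_generators)
  then show "\<exists>n (A :: 'k mat set). commuting_open_orbit_generators n A \<and>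
      lie_isomorphic class_ring G (semidirect n (mat_span n A))"
    using semidirect_isomorphic by (intro exI[of _ half_dim] exI[of _ A]) simp
qed

end
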